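(* All the polynomials $J_\lambda$ ($\lambda$ a partition of a positive integer) can be recursively calculated from $J_{1}=1$ using the following two equations: (i) for all partitions $\lambda=(\lambda_1,\lambda_2,\dots,\lambda_r)$ with $r\ge2$, $$J_\lambda=(|\lambda|-1)\binom{|\lambda|-2}{\lambda_r-1}q^{-(r-1)\lambda_r}\,J_{\lambda_r}\,J_{\lambda^*}+(q-1)\sum_{i=1}^{r-1}q^{\lambda_r(i-r)}\,J_{\lambda^{(i)}};$$ (ii) for $n\ge2$, $$J_n=(n-1)\sum_{|\lambda|=n-1}\frac{J_\lambda}{m(\lambda)!}\,q^{n(\lambda)}.$$
   Context: Let $\Lambda$ be the algebra of symmetric functions in $x_1,x_2,\dots$ over $\mathbb{Q}(q)$, with monomial symmetric functions $m_\lambda$ and elementary symmetric functions $e_n$ ($e_0=1$). The specialization considered is the $\mathbb{Q}(q)$-algebra homomorphism $\Lambda\to\mathbb{Q}(q)$ determined by $e_n\mapsto q^{\binom n2}/n!$; symmetric functions are identified with their images. For a partition $\lambda=(\lambda_1\ge\dots\ge\lambda_r>0)$: $|\lambda|=\lambda_1+\dots+\lambda_r$, $l(\lambda)=r$, $n(\lambda)=\sum_{i\ge1}(i-1)\lambda_i$; if $r_i$ is the number of parts of $\lambda$ equal to $i$, then $m(\lambda)!=r_1!\,r_2!\cdots$. $J_\lambda\in\mathbb{Z}[q]$ is the polynomial defined, under this specialization, by $$m_\lambda=(1-q)^{|\lambda|-l(\lambda)}\frac{q^{n(\lambda)}}{(|\lambda|-1)!\,m(\lambda)!}J_\lambda .$$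 For a positive integer $n$, $J_n$ denotes $J_{(n)}$, where $(n)$ is the partition with the single part $n$. For $\lambda=(\lambda_1,\dots,\lambda_r)$ with $r\ge2$: $\lambda^*=(\lambda_1,\dots,\lambda_{r-1})$, and for $1\le i\le r-1$, $\lambda^{(i)}$ is the partition obtained by rearranging $(\lambda_1,\dots,\lambda_{i-1},\lambda_i+\lambda_r,\lambda_{i+1},\dots,\lambda_{r-1})$ in non-increasing order.
   Formalization: Equation (i) as printed fails for λ=(1,1,1); it is corrected by multiplying the i-th summand by q^{n(λ^{(i)})−n(merged sequence before rearrangement)}, so its power of q is n(λ^{(i)})−n(λ); this factor is 1 when no rearrangement is needed. *)

theory Defs
  imports
    "HOL-Computational_Algebra.Computational_Algebra"
    "HOL-Library.Poly_Mapping"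
begin

section \<open>Partitions\<close>

definition is_partition :: "nat list \<Rightarrow> bool" where
  "is_partition la \<longleftrightarrow> sorted_wrt (\<ge>) la \<and> 0 \<notin> set la"

text \<open>Lists are indexed from 0, so this is the sum of \<open>(i - 1) \<lambda>\<^sub>i\<close> over \<open>i \<ge> 1\<close>. It is
  also applied to compositions that are not sorted.\<close>
definition nstat :: "nat list \<Rightarrow> nat" where
  "nstat la = (\<Sum>i<length la. i * la ! i)"

definition mult_fact :: "nat list \<Rightarrow> nat" where
  "mult_fact la = (\<Prod>k\<in>set la. fact (count_list la k))"

text \<open>\<open>merged la i\<close> is \<open>(\<lambda>\<^sub>1, \<dots>, \<lambda>\<^sub>i + \<lambda>\<^sub>r, \<dots>, \<lambda>\<^sub>r\<^sub>-\<^sub>1)\<close> with the index \<open>i\<close> counted from 1,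
  before the rearrangement; \<open>merge_part la i\<close> is \<open>\<lambda>\<close> with superscript \<open>(i)\<close>.
  The partition \<open>\<lambda>\<^sup>*\<close> is \<open>butlast la\<close>, and \<open>\<lambda>\<^sub>r\<close> is \<open>last la\<close>.\<close>
definition merged :: "nat list \<Rightarrow> nat \<Rightarrow> nat list" where
  "merged la i = (butlast la)[i - 1 := la ! (i - 1) + last la]"

definition merge_part :: "nat list \<Rightarrow> nat \<Rightarrow> nat list" where
  "merge_part la i = rev (sort (merged la i))"

section \<open>The field \<open>\<rat>(q)\<close>\<close>

type_synonym ratfun = "rat poly fract"

definition q :: ratfun where
  "q = to_fract [:0, 1:]"

definition of_int_poly_q :: "int poly \<Rightarrow> ratfun" where
  "of_int_poly_q p = to_fract (map_poly rat_of_int p)"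

section \<open>Symmetric functions\<close>

text \<open>A formal series in the variables indexed by \<^typ>\<open>nat\<close> is given by its coefficient at each
  monomial, a monomial being its finitely supported exponent vector. A symmetric function is a
  series of bounded degree that is invariant under permutations of the variables.\<close>

type_synonym monomial = "nat \<Rightarrow>\<^sub>0 nat"
type_synonym series = "monomial \<Rightarrow> ratfun"

definition mon_degree :: "monomial \<Rightarrow> nat" where
  "mon_degree \<alpha> = (\<Sum>i\<in>Poly_Mapping.keys \<alpha>. Poly_Mapping.lookup \<alpha> i)"

definition Sym :: "series set" where
  "Sym = {f. (\<exists>d. \<forall>\<alpha>. f \<alpha> \<noteq> 0 \<longrightarrow> mon_degree \<alpha> \<le> d) \<and>
             (\<forall>\<pi> \<alpha>. bij \<pi> \<longrightarrow> f (Poly_Mapping.map_key \<pi> \<alpha>) = f \<alpha>)}"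

definition series_one :: series where
  "series_one = (\<lambda>\<alpha>. if \<alpha> = 0 then 1 else 0)"

definition series_add :: "series \<Rightarrow> series \<Rightarrow> series" where
  "series_add f g = (\<lambda>\<alpha>. f \<alpha> + g \<alpha>)"

definition series_scale :: "ratfun \<Rightarrow> series \<Rightarrow> series" where
  "series_scale c f = (\<lambda>\<alpha>. c * f \<alpha>)"

text \<open>The index set is finite, since \<open>\<beta>\<close> and \<open>\<gamma>\<close> are bounded by \<open>\<alpha>\<close>
  (lemma \<open>finite_decompositions\<close>).\<close>
definition series_mult :: "series \<Rightarrow> series \<Rightarrow> series" where
  "series_mult f g = (\<lambda>\<alpha>. \<Sum>(\<beta>, \<gamma>)\<in>{(\<beta>, \<gamma>). \<beta> + \<gamma> = \<alpha>}. f \<beta> * g \<gamma>)"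

lemma finite_decompositions:
  fixes \<alpha> :: monomial
  shows "finite {(\<beta>, \<gamma>). \<beta> + \<gamma> = \<alpha>}"
proof -
  define F where "F = {f. \<forall>i. (i \<in> Poly_Mapping.keys \<alpha> \<longrightarrow> f i \<in> {..mon_degree \<alpha>}) \<and>
                    (i \<notin> Poly_Mapping.keys \<alpha> \<longrightarrow> f i = (0::nat))}"
  have "finite F"
    unfolding F_def by (rule finite_set_of_finite_funs) simp_all
  then have fin: "finite (Poly_Mapping.lookup -` F :: monomial set)"
    by (rule finite_vimageI) (simp add: inj_on_def)
  have le: "Poly_Mapping.lookup \<alpha> i \<le> mon_degree \<alpha>" for i
  proof (cases "i \<in> Poly_Mapping.keys \<alpha>")
    case True
    then show ?thesis
      unfolding mon_degree_def by (intro member_le_sum) simp_all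
  qed (simp add: not_in_keys_iff_lookup_eq_zero)
  have mem: "Poly_Mapping.lookup \<beta> \<in> F"
    if b: "\<And>i. Poly_Mapping.lookup \<beta> i \<le> Poly_Mapping.lookup \<alpha> i" for \<beta> :: monomial
  proof -
    have "Poly_Mapping.lookup \<beta> i \<le> mon_degree \<alpha>" for i
      using b[of i] le[of i] by (rule order_trans)
    moreover have "Poly_Mapping.lookup \<beta> i = 0" if "i \<notin> Poly_Mapping.keys \<alpha>" for i
      using b[of i] that by (simp add: not_in_keys_iff_lookup_eq_zero)
    ultimately show ?thesis
      unfolding F_def by blast
  qed
  have "{(\<beta>, \<gamma>). \<beta> + \<gamma> = \<alpha>} \<subseteq>
          (Poly_Mapping.lookup -` F) \<times> (Poly_Mapping.lookup -` F)"
  proof (rule subsetI)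
    fix p :: "monomial \<times> monomial"
    assume "p \<in> {(\<beta>, \<gamma>). \<beta> + \<gamma> = \<alpha>}"
    then have "fst p + snd p = \<alpha>"
      by (simp add: case_prod_beta)
    then have "Poly_Mapping.lookup (fst p) \<in> F" "Poly_Mapping.lookup (snd p) \<in> F"
      by (auto intro!: mem simp: lookup_add)
    then show "p \<in> (Poly_Mapping.lookup -` F) \<times> (Poly_Mapping.lookup -` F)"
      by (simp add: mem_Times_iff)
  qed
  then show ?thesis
    by (rule finite_subset) (intro finite_cartesian_product fin)
qed

text \<open>Monomial symmetric function: the sum of the monomials whose nonzero exponents are, up to
  order, the parts of the partition.\<close>
definition msym :: "nat list \<Rightarrow> series" where
  "msym la = (\<lambda>\<alpha>. if image_mset (Poly_Mapping.lookup \<alpha>) (mset_set (Poly_Mapping.keys \<alpha>)) = mset la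
                  then 1 else 0)"

text \<open>Elementary symmetric function: the sum of the products of \<open>n\<close> distinct variables.\<close>
definition esym :: "nat \<Rightarrow> series" where
  "esym n = (\<lambda>\<alpha>. if card (Poly_Mapping.keys \<alpha>) = n \<and> (\<forall>i. Poly_Mapping.lookup \<alpha> i \<le> 1)
                 then 1 else 0)"

text \<open>Only the values on \<^const>\<open>Sym\<close> matter.\<close>
definition Sym_algebra_hom :: "(series \<Rightarrow> ratfun) \<Rightarrow> bool" where
  "Sym_algebra_hom \<phi> \<longleftrightarrow>
     \<phi> series_one = 1 \<and>
     (\<forall>f\<in>Sym. \<forall>g\<in>Sym. \<phi> (series_add f g) = \<phi> f + \<phi> g) \<and>
     (\<forall>f\<in>Sym. \<forall>g\<in>Sym. \<phi> (series_mult f g) = \<phi> f * \<phi> g) \<and>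
     (\<forall>c. \<forall>f\<in>Sym. \<phi> (series_scale c f) = c * \<phi> f)"

definition is_specialization :: "(series \<Rightarrow> ratfun) \<Rightarrow> bool" where
  "is_specialization \<phi> \<longleftrightarrow>
     Sym_algebra_hom \<phi> \<and> (\<forall>n. \<phi> (esym n) = q ^ (n choose 2) / fact n)"

section \<open>The polynomials \<open>J\<close> and the recursion\<close>

definition J :: "(series \<Rightarrow> ratfun) \<Rightarrow> nat list \<Rightarrow> int poly" where
  "J \<phi> la = (THE p. \<phi> (msym la) =
     (1 - q) ^ (sum_list la - length la) *
     (q ^ nstat la / (fact (sum_list la - 1) * of_nat (mult_fact la))) * of_int_poly_q p)"

abbreviation Jq :: "(series \<Rightarrow> ratfun) \<Rightarrow> nat list \<Rightarrow> ratfun" where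
  "Jq \<phi> la \<equiv> of_int_poly_q (J \<phi> la)"

text \<open>The right-hand sides of the two equations, for arbitrary values \<open>K\<close> in place of \<open>J\<close>.

  In the first one, the power of \<open>q\<close> in front of the \<open>i\<close>-th term of the sum is \<open>q\<close> to the
  \<open>\<lambda>\<^sub>r (i - r)\<close>, times a second factor. The published formula has only the first factor. That is
  correct when \<open>merged la i\<close> is already sorted, and the second factor is then 1. Otherwise the
  rearrangement lowers \<^const>\<open>nstat\<close> and the second factor is needed: for \<open>\<lambda> = (1, 1, 1)\<close> one has
  \<open>J = 2\<close>, while the formula without it gives \<open>(2 + (q\<^sup>2 - 1) (1 + q)) / q\<^sup>2\<close>. The two factors
  together are \<open>q\<close> to the power \<open>nstat (merge_part la i) - nstat la\<close>.\<close>

definition rhs_split :: "(nat list \<Rightarrow> ratfun) \<Rightarrow> nat list \<Rightarrow> ratfun" where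
  "rhs_split K la =
     (let r = length la; l = last la; N = sum_list la in
        of_nat ((N - 1) * ((N - 2) choose (l - 1))) * q powi (- (int (r - 1) * int l)) *
          K [l] * K (butlast la)
      + (q - 1) * (\<Sum>i=1..r - 1.
          q powi (int l * (int i - int r)) *
          q powi (int (nstat (merge_part la i)) - int (nstat (merged la i))) *
          K (merge_part la i)))"

definition rhs_single :: "(nat list \<Rightarrow> ratfun) \<Rightarrow> nat \<Rightarrow> ratfun" where
  "rhs_single K n =
     of_nat (n - 1) *
     (\<Sum>la\<in>{la. is_partition la \<and> sum_list la = n - 1}.
        K la / of_nat (mult_fact la) * q ^ nstat la)"

text \<open>\<open>calculated la v\<close>: the value \<open>v\<close> is obtained for \<open>la\<close> by finitely many uses of the two
  equations, starting from the value 1 for the partition (1); each use needs all values on its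
  right-hand side to have been obtained before.\<close>
inductive calculated :: "nat list \<Rightarrow> ratfun \<Rightarrow> bool" where
  start: "calculated [1] 1"
| split: "\<lbrakk>is_partition la; length la \<ge> 2;
           calculated [last la] (K [last la]);
           calculated (butlast la) (K (butlast la));
           \<And>i. i \<in> {1..length la - 1} \<Longrightarrow> calculated (merge_part la i) (K (merge_part la i))\<rbrakk>
          \<Longrightarrow> calculated la (rhs_split K la)"
| single: "\<lbrakk>n \<ge> 2;
            \<And>la. is_partition la \<Longrightarrow> sum_list la = n - 1 \<Longrightarrow> calculated la (K la)\<rbrakk>
           \<Longrightarrow> calculated [n] (rhs_single K n)"

end

theory Submission
  imports Defs "HOL-Combinatorics.Permutations"
begin

text \<open>Write \<open>p\<^sub>l\<close> for the power sums. Comparing coefficients in \<open>p\<^sub>l m\<^sub>\<mu>\<close> gives equation (i).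

  Newton's identities read \<open>E'(t) = P(-t) E(t)\<close>, where \<open>P(t) = \<Sum> p\<^sub>n\<^sub>+\<^sub>1 t\<^sup>n\<close>, and under the
  specialization \<open>E'(t) = E(q t)\<close>. Hence \<open>P\<close> satisfies \<open>P'(t) = (P(t) - q P(q t)) P(t)\<close>. The
  series \<open>G(t)\<close> with \<open>t\<^sup>n\<close>-coefficient \<open>\<Sum> (1 - q)^l(\<lambda>) m\<^sub>\<lambda>\<close>, over \<open>|\<lambda>| = n\<close>, satisfies \<open>G'(t) = (P(t) - q P(q t)) G(t)\<close>, so \<open>G = P\<close>,
  which is equation (ii). The differential equation for \<open>P\<close> is also a recurrence
  \<open>J\<^sub>n\<^sub>+\<^sub>2 = \<Sum> binom(n, i) (1 + q + \<dots> + q\<^sup>i) J\<^sub>i\<^sub>+\<^sub>1 J\<^sub>n\<^sub>-\<^sub>i\<^sub>+\<^sub>1\<close>, so \<open>J\<^sub>n\<close> has integer coefficients.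

  Equation (i) then shows that \<open>J\<^sub>\<lambda>\<close> is an integral Laurent polynomial. That no negative powers of
  \<open>q\<close> occur follows from the divisibility of \<open>m\<^sub>\<lambda>\<close> by \<open>q\<close> to the \<open>n(\<lambda>)\<close> in \<open>\<rat>[q]\<close>: if \<open>\<mu>\<close> is \<open>\<lambda>\<close>
  without its first column, of length \<open>r\<close>, then \<open>e\<^sub>r m\<^sub>\<mu>\<close> is \<open>m\<^sub>\<lambda>\<close> plus terms \<open>m\<^sub>\<nu>\<close> with \<open>\<nu>\<close> longer
  than \<open>\<lambda>\<close> and \<open>n(\<nu>) \<ge> n(\<lambda>)\<close>.\<close>

section \<open>Exponent multisets and series depending only on them\<close>

lemma rev_sort_partition:
  assumes "is_partition xs"
  shows "rev (sort xs) = xs"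
proof -
  have "sorted (rev xs)"
    using assms by (simp add: is_partition_def sorted_wrt_rev)
  then have "sort xs = rev xs"
    by (intro properties_for_sort) simp_all
  then show ?thesis
    by simp
qed

definition exponents :: "monomial \<Rightarrow> nat multiset" where
  "exponents \<alpha> = image_mset (Poly_Mapping.lookup \<alpha>) (mset_set (Poly_Mapping.keys \<alpha>))"

text \<open>By \<open>Sym_eq_class_series\<close> every symmetric function has this form, so
  coefficients can be computed on multisets of exponents instead of exponent vectors. Since
  \<open>exponents\<close> never contains 0, the values of \<open>F\<close> at multisets containing
  0 have no influence.\<close>

definition class_series :: "(nat multiset \<Rightarrow> ratfun) \<Rightarrow> series" where
  "class_series F = (\<lambda>\<alpha>. F (exponents \<alpha>))"

definition mset_series :: "nat multiset \<Rightarrow> series" where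
  "mset_series A = class_series (\<lambda>B. if B = A then 1 else 0)"

text \<open>Partitions as multisets: adding, removing or changing a part then requires no sorting.
  \<open>bij_betw_partitions\<close> translates back to sorted lists.\<close>

definition mset_partitions :: "nat \<Rightarrow> nat multiset set" where
  "mset_partitions N = {A. 0 \<notin># A \<and> sum_mset A = N}"

lemma msym_eq_mset_series: "msym la = mset_series (mset la)"
  by (simp add: msym_def mset_series_def class_series_def exponents_def)

lemma exponents_superset:
  assumes "finite K" "Poly_Mapping.keys \<alpha> \<subseteq> K"
  shows "exponents \<alpha> = filter_mset (\<lambda>b. b \<noteq> 0) (image_mset (Poly_Mapping.lookup \<alpha>) (mset_set K))"
proof -
  have "{x \<in> K. Poly_Mapping.lookup \<alpha> x \<noteq> 0} = Poly_Mapping.keys \<alpha>"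
    using assms(2) by (auto simp: in_keys_iff)
  then show ?thesis
    using assms by (simp add: exponents_def filter_mset_image_mset filter_mset_mset_set)
qed

lemma image_lookup_superset:
  assumes "finite K" "Poly_Mapping.keys \<alpha> \<subseteq> K"
  shows "image_mset (Poly_Mapping.lookup \<alpha>) (mset_set K)
           = exponents \<alpha> + replicate_mset (card K - size (exponents \<alpha>)) 0"
proof -
  let ?k = "Poly_Mapping.keys \<alpha>"
  have "mset_set K = mset_set ?k + mset_set (K - ?k)"
    using mset_set_Union[of ?k "K - ?k"] assms by (simp add: Un_absorb1)
  moreover have "image_mset (Poly_Mapping.lookup \<alpha>) (mset_set (K - ?k))
      = image_mset (\<lambda>_. 0) (mset_set (K - ?k))"
    using assms by (intro image_mset_cong) (simp add: in_keys_iff)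
  ultimately show ?thesis
    using assms by (simp add: exponents_def image_mset_const_eq card_Diff_subset)
qed

lemma zero_notin_exponents [simp]: "0 \<notin># exponents \<alpha>"
  by (auto simp: exponents_def in_keys_iff)

lemma sum_mset_exponents: "sum_mset (exponents \<alpha>) = mon_degree \<alpha>"
  by (simp add: exponents_def mon_degree_def sum_unfold_sum_mset)

lemma exponents_in_mset_partitions: "exponents \<alpha> \<in> mset_partitions N \<longleftrightarrow> mon_degree \<alpha> = N"
  by (simp add: mset_partitions_def sum_mset_exponents)

lemma size_exponents: "size (exponents \<alpha>) = card (Poly_Mapping.keys \<alpha>)"
  by (simp add: exponents_def)

lemma exponents_map_key:
  assumes "bij \<pi>"
  shows "exponents (Poly_Mapping.map_key \<pi> \<alpha>) = exponents \<alpha>"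
proof -
  let ?k = "Poly_Mapping.keys \<alpha>"
  have inj: "inj \<pi>" and surj: "surj \<pi>"
    using assms by (auto simp: bij_def)
  have "inj_on \<pi> (\<pi> -` ?k)"
    using inj by (rule inj_on_subset) simp
  then have "mset_set ?k = image_mset \<pi> (mset_set (\<pi> -` ?k))"
    using surj by (simp add: image_mset_mset_set)
  then show ?thesis
    by (simp add: exponents_def keys_map_key[OF inj] map_key.rep_eq[OF inj] multiset.map_comp)
qed

text \<open>On the union \<open>K\<close> of the two supports both vectors take the same multiset of
  values, padded with equally many zeros. Hence a permutation of \<open>K\<close> carries one vector
  to the other, and outside \<open>K\<close> both vanish.\<close>

lemma same_exponents_map_key:
  assumes "exponents \<alpha> = exponents \<beta>"
  obtains \<pi> where "bij \<pi>" "Poly_Mapping.map_key \<pi> \<alpha> = \<beta>"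
proof -
  define K where "K = Poly_Mapping.keys \<alpha> \<union> Poly_Mapping.keys \<beta>"
  have K: "finite K" "Poly_Mapping.keys \<alpha> \<subseteq> K" "Poly_Mapping.keys \<beta> \<subseteq> K"
    by (auto simp: K_def)
  have "image_mset (Poly_Mapping.lookup \<beta>) (mset_set K) = image_mset (Poly_Mapping.lookup \<alpha>) (mset_set K)"
    using K assms by (simp add: image_lookup_superset)
  then obtain p where p: "p permutes K" "\<forall>x\<in>K. Poly_Mapping.lookup \<beta> x = Poly_Mapping.lookup \<alpha> (p x)"
    using image_mset_eq_implies_permutes[OF K(1)] by blast
  have bij: "bij p"
    using p(1) by (rule permutes_bij)
  have "Poly_Mapping.lookup \<alpha> (p x) = Poly_Mapping.lookup \<beta> x" for x
  proof (cases "x \<in> K")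
    case False
    then have "p x \<notin> Poly_Mapping.keys \<alpha>" "x \<notin> Poly_Mapping.keys \<beta>"
      using K p(1) by (auto simp: permutes_not_in)
    then show ?thesis
      by (simp add: in_keys_iff)
  qed (use p in simp)
  then have "Poly_Mapping.map_key p \<alpha> = \<beta>"
    by (intro poly_mapping_eqI) (simp add: map_key.rep_eq bij bij_is_inj)
  with bij show ?thesis
    by (rule that)
qed

lemma filter_nonzero:
  fixes A :: "nat multiset"
  assumes "0 \<notin># A"
  shows "filter_mset (\<lambda>b. b \<noteq> 0) A = A"
  using assms by (induction A) auto

text \<open>There are infinitely many variables, so each further part can be placed at an index
  outside the current support.\<close>

lemma ex_exponents:
  assumes "0 \<notin># A"
  obtains \<alpha> where "exponents \<alpha> = A"
proof -
  have "\<exists>\<alpha>. exponents \<alpha> = A"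
    using assms
  proof (induction A)
    case empty
    then show ?case
      by (intro exI[of _ 0]) (simp add: exponents_def)
  next
    case (add a A)
    then obtain \<alpha> where \<alpha>: "exponents \<alpha> = A"
      by auto
    obtain i where i: "i \<notin> Poly_Mapping.keys \<alpha>"
      using ex_new_if_finite[OF infinite_UNIV_nat finite_keys] by blast
    let ?\<beta> = "\<alpha> + Poly_Mapping.single i a"
    have a: "a \<noteq> 0"
      using add.prems by auto
    have "Poly_Mapping.keys ?\<beta> \<subseteq> insert i (Poly_Mapping.keys \<alpha>)"
      using Poly_Mapping.keys_add[of \<alpha> "Poly_Mapping.single i a"] by (auto split: if_splits)
    moreover have "image_mset (Poly_Mapping.lookup ?\<beta>) (mset_set (Poly_Mapping.keys \<alpha>)) = A"
      unfolding \<alpha>[symmetric] exponents_def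
      using i by (intro image_mset_cong) (auto simp: lookup_add lookup_single when_def)
    ultimately have "exponents ?\<beta> = filter_mset (\<lambda>b. b \<noteq> 0) (add_mset a A)"
      using i by (subst exponents_superset[of "insert i (Poly_Mapping.keys \<alpha>)"])
        (auto simp: lookup_add lookup_single in_keys_iff)
    also have "\<dots> = add_mset a A"
      using filter_nonzero[OF add.prems] .
    finally show ?case
      by blast
  qed
  then show ?thesis
    using that by blast
qed

lemma size_le_sum_mset:
  fixes A :: "nat multiset"
  shows "0 \<notin># A \<Longrightarrow> size A \<le> sum_mset A"
  by (induction A) auto

lemma finite_mset_partitions: "finite (mset_partitions N)"
proof -
  have "mset_partitions N \<subseteq> mset ` {xs. set xs \<subseteq> {..N} \<and> length xs \<le> N}"
  proof
    fix A assume A: "A \<in> mset_partitions N"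
    have "set (sorted_list_of_multiset A) \<subseteq> {..N}"
    proof
      fix a assume "a \<in> set (sorted_list_of_multiset A)"
      then have "a \<in># A"
        by simp
      then show "a \<in> {..N}"
        using A by (auto simp: mset_partitions_def dest!: multi_member_split)
    qed
    moreover have "length (sorted_list_of_multiset A) \<le> N"
      using A size_le_sum_mset[of A]
      by (simp add: mset_partitions_def flip: size_mset)
    ultimately show "A \<in> mset ` {xs. set xs \<subseteq> {..N} \<and> length xs \<le> N}"
      by (intro image_eqI[of _ _ "sorted_list_of_multiset A"]) auto
  qed
  then show ?thesis
    by (rule finite_subset) (intro finite_imageI finite_lists_length_le finite_atMost)
qed

lemma bij_betw_partitions:
  "bij_betw mset {la. is_partition la \<and> sum_list la = N} (mset_partitions N)"
proof (rule bij_betwI[where g = "\<lambda>A. rev (sorted_list_of_multiset A)"])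
  show "mset \<in> {la. is_partition la \<and> sum_list la = N} \<rightarrow> mset_partitions N"
    by (auto simp: mset_partitions_def is_partition_def sum_mset_sum_list)
  show "(\<lambda>A. rev (sorted_list_of_multiset A)) \<in> mset_partitions N \<rightarrow> {la. is_partition la \<and> sum_list la = N}"
    by (auto simp: mset_partitions_def is_partition_def sorted_wrt_rev simp flip: sum_mset_sum_list)
qed (auto simp: rev_sort_partition)

lemma class_series_Sym:
  assumes "\<And>A. 0 \<notin># A \<Longrightarrow> F A \<noteq> 0 \<Longrightarrow> sum_mset A \<le> d"
  shows "class_series F \<in> Sym"
proof -
  have "\<forall>\<alpha>. class_series F \<alpha> \<noteq> 0 \<longrightarrow> mon_degree \<alpha> \<le> d"
    using assms[OF zero_notin_exponents] by (simp add: class_series_def sum_mset_exponents)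
  moreover have "\<forall>\<pi> \<alpha>. bij \<pi> \<longrightarrow> class_series F (Poly_Mapping.map_key \<pi> \<alpha>) = class_series F \<alpha>"
    by (simp add: class_series_def exponents_map_key)
  ultimately show ?thesis
    unfolding Sym_def by blast
qed

lemma mset_series_Sym [simp]: "mset_series A \<in> Sym"
  unfolding mset_series_def by (rule class_series_Sym[of _ "sum_mset A"]) (auto split: if_splits)

text \<open>\<open>F\<close> reads the coefficient off a chosen representative; the choice is
  harmless because two monomials with equal exponent multisets differ by a permutation of the
  variables, under which \<open>f\<close> is invariant.\<close>

lemma Sym_eq_class_series:
  assumes "f \<in> Sym"
  obtains F where "f = class_series F" "\<And>\<alpha>. F (exponents \<alpha>) = f \<alpha>"
proof
  define F where "F A = f (SOME \<alpha>. exponents \<alpha> = A)" for A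
  show F: "F (exponents \<alpha>) = f \<alpha>" for \<alpha>
  proof -
    let ?\<beta> = "SOME \<beta>. exponents \<beta> = exponents \<alpha>"
    have "exponents ?\<beta> = exponents \<alpha>"
      by (rule someI[of _ \<alpha>]) simp
    then obtain \<pi> where "bij \<pi>" "Poly_Mapping.map_key \<pi> ?\<beta> = \<alpha>"
      by (rule same_exponents_map_key)
    then show ?thesis
      using assms unfolding F_def Sym_def by (metis (mono_tags, lifting) mem_Collect_eq)
  qed
  show "f = class_series F"
    by (simp add: class_series_def F)
qed

lemma series_scale_Sym: "f \<in> Sym \<Longrightarrow> series_scale c f \<in> Sym"
  by (auto simp: Sym_def series_scale_def)

lemma series_add_Sym:
  assumes "f \<in> Sym" "g \<in> Sym" shows "series_add f g \<in> Sym"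
proof -
  obtain d e where "\<forall>\<alpha>. f \<alpha> \<noteq> 0 \<longrightarrow> mon_degree \<alpha> \<le> d" "\<forall>\<alpha>. g \<alpha> \<noteq> 0 \<longrightarrow> mon_degree \<alpha> \<le> e"
    using assms by (auto simp: Sym_def)
  then have "\<forall>\<alpha>. series_add f g \<alpha> \<noteq> 0 \<longrightarrow> mon_degree \<alpha> \<le> max d e"
    by (metis series_add_def add.right_neutral max.coboundedI1 max.coboundedI2)
  then show ?thesis
    using assms by (auto simp: Sym_def series_add_def)
qed

lemma mon_degree_add: "mon_degree (\<alpha> + \<beta>) = mon_degree \<alpha> + mon_degree \<beta>"
proof -
  have *: "mon_degree \<gamma> = (\<Sum>i\<in>K. Poly_Mapping.lookup \<gamma> i)"
    if "Poly_Mapping.keys \<gamma> \<subseteq> K" "finite K" for \<gamma> K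
    unfolding mon_degree_def using that by (intro sum.mono_neutral_left) (auto simp: in_keys_iff)
  let ?K = "Poly_Mapping.keys \<alpha> \<union> Poly_Mapping.keys \<beta>"
  show ?thesis
    using Poly_Mapping.keys_add[of \<alpha> \<beta>]
    by (simp add: *[of _ ?K] lookup_add sum.distrib)
qed

lemma series_mult_Sym:
  assumes "f \<in> Sym" "g \<in> Sym" shows "series_mult f g \<in> Sym"
proof -
  obtain d e where d: "\<And>\<alpha>. f \<alpha> \<noteq> 0 \<Longrightarrow> mon_degree \<alpha> \<le> d" and e: "\<And>\<alpha>. g \<alpha> \<noteq> 0 \<Longrightarrow> mon_degree \<alpha> \<le> e"
    using assms by (auto simp: Sym_def)
  have "mon_degree \<alpha> \<le> d + e" if nz: "series_mult f g \<alpha> \<noteq> 0" for \<alpha>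
  proof -
    obtain p where "p \<in> {(\<beta>, \<gamma>). \<beta> + \<gamma> = \<alpha>}" "(case p of (\<beta>, \<gamma>) \<Rightarrow> f \<beta> * g \<gamma>) \<noteq> 0"
      using nz unfolding series_mult_def by (rule sum.not_neutral_contains_not_neutral)
    then show ?thesis
      using d[of "fst p"] e[of "snd p"] by (auto simp: mon_degree_add)
  qed
  moreover have "series_mult f g (Poly_Mapping.map_key \<pi> \<alpha>) = series_mult f g \<alpha>" if \<pi>: "bij \<pi>" for \<pi> \<alpha>
  proof -
    let ?m = "Poly_Mapping.map_key \<pi> :: monomial \<Rightarrow> monomial"
    let ?i = "Poly_Mapping.map_key (inv \<pi>) :: monomial \<Rightarrow> monomial"
    have inj: "inj \<pi>" "inj (inv \<pi>)"
      using \<pi> by (auto simp: bij_is_inj bij_imp_bij_inv)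
    have inv: "?m (?i \<beta>) = \<beta>" "?i (?m \<beta>) = \<beta>" for \<beta>
      using \<pi> inj by (simp_all add: map_key_compose bij_is_surj surj_f_inv_f[of \<pi>] inv_f_f map_key_id o_def)
    \<comment> \<open>Renaming the variables in both factors maps the decompositions of one monomial
      bijectively to those of the other, with the renaming by \<open>inv \<pi>\<close> as
      inverse.\<close>
    have "(\<Sum>(\<beta>, \<gamma>)\<in>{(\<beta>, \<gamma>). \<beta> + \<gamma> = ?m \<alpha>}. f \<beta> * g \<gamma>) = (\<Sum>(\<beta>, \<gamma>)\<in>{(\<beta>, \<gamma>). \<beta> + \<gamma> = \<alpha>}. f \<beta> * g \<gamma>)"
    proof (rule sum.reindex_bij_witness[where i = "map_prod ?m ?m" and j = "map_prod ?i ?i"])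
      fix p assume "p \<in> {(\<beta>, \<gamma>). \<beta> + \<gamma> = ?m \<alpha>}"
      then show "map_prod ?i ?i p \<in> {(\<beta>, \<gamma>). \<beta> + \<gamma> = \<alpha>}"
        by (auto simp: inv simp flip: map_key_plus[OF inj(2)])
    next
      fix p assume "p \<in> {(\<beta>, \<gamma>). \<beta> + \<gamma> = \<alpha>}"
      then show "map_prod ?m ?m p \<in> {(\<beta>, \<gamma>). \<beta> + \<gamma> = ?m \<alpha>}"
        by (auto simp: map_key_plus[OF inj(1)])
    next
      fix p assume "p \<in> {(\<beta>, \<gamma>). \<beta> + \<gamma> = ?m \<alpha>}"
      have "h (?i \<beta>) = h \<beta>" if "h \<in> Sym" for h \<beta>
        using that bij_imp_bij_inv[OF \<pi>] by (simp add: Sym_def)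
      from this[OF assms(1)] this[OF assms(2)]
      show "(case map_prod ?i ?i p of (\<beta>, \<gamma>) \<Rightarrow> f \<beta> * g \<gamma>) = (case p of (\<beta>, \<gamma>) \<Rightarrow> f \<beta> * g \<gamma>)"
        by (simp split: prod.split)
    qed (auto simp: inv)
    then show ?thesis
      by (simp add: series_mult_def)
  qed
  ultimately show ?thesis
    unfolding Sym_def by blast
qed

lemma exponents_eq_replicate_1:
  "exponents \<alpha> = replicate_mset n 1
    \<longleftrightarrow> card (Poly_Mapping.keys \<alpha>) = n \<and> (\<forall>i. Poly_Mapping.lookup \<alpha> i \<le> 1)"
proof
  assume *: "exponents \<alpha> = replicate_mset n 1"
  have "Poly_Mapping.lookup \<alpha> i \<le> 1" for i
  proof (cases "i \<in> Poly_Mapping.keys \<alpha>")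
    case True
    then have "Poly_Mapping.lookup \<alpha> i \<in># exponents \<alpha>"
      by (simp add: exponents_def)
    then show ?thesis
      by (simp add: * split: if_splits)
  qed (simp add: in_keys_iff)
  then show "card (Poly_Mapping.keys \<alpha>) = n \<and> (\<forall>i. Poly_Mapping.lookup \<alpha> i \<le> 1)"
    using * by (simp flip: size_exponents)
next
  assume *: "card (Poly_Mapping.keys \<alpha>) = n \<and> (\<forall>i. Poly_Mapping.lookup \<alpha> i \<le> 1)"
  have "exponents \<alpha> = image_mset (\<lambda>_. 1) (mset_set (Poly_Mapping.keys \<alpha>))"
    unfolding exponents_def
  proof (rule image_mset_cong)
    fix x assume "x \<in># mset_set (Poly_Mapping.keys \<alpha>)"
    then have "Poly_Mapping.lookup \<alpha> x \<noteq> 0"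
      by (simp add: in_keys_iff)
    with * show "Poly_Mapping.lookup \<alpha> x = 1"
      by (metis le_antisym less_one not_le)
  qed
  then show "exponents \<alpha> = replicate_mset n 1"
    using * by (simp add: image_mset_const_eq)
qed

lemma esym_eq_mset_series: "esym n = mset_series (replicate_mset n 1)"
  unfolding esym_def mset_series_def class_series_def exponents_eq_replicate_1 ..

section \<open>Multiplication by a power sum\<close>

text \<open>Multiplication by p_l = m_(l). A monomial \<alpha> is x_i^l times a remainder in one way
  for each variable i whose exponent b is at least l; the remainder has b lowered to b - l, a part
  that disappears when b = l. The sum over a multiset counts variables with equal exponents
  separately.\<close>

lemma series_mult_one_part:
  assumes l: "l > 0"
  shows "series_mult (mset_series {#l#}) (class_series F)
    = class_series (\<lambda>B. \<Sum>b\<in>#filter_mset (\<lambda>b. l \<le> b) B.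
        F (B - {#b#} + (if b = l then {#} else {#b - l#})))"
proof
  fix \<alpha> :: monomial
  let ?k = "Poly_Mapping.keys \<alpha>" and ?a = "Poly_Mapping.lookup \<alpha>"
  let ?s = "\<lambda>i. Poly_Mapping.single i l"
  let ?I = "{i \<in> ?k. l \<le> ?a i}"
  let ?h = "\<lambda>i. (?s i, \<alpha> - ?s i)"
  let ?D = "{(\<beta>, \<gamma>). \<beta> + \<gamma> = \<alpha>}"
  let ?G = "\<lambda>b. F (exponents \<alpha> - {#b#} + (if b = l then {#} else {#b - l#}))"
  have exp_single: "exponents (?s i) = {#l#}" for i
    using l by (simp add: exponents_def)
  have single: "\<exists>i. \<beta> = ?s i" if "exponents \<beta> = {#l#}" for \<beta>
  proof -
    have "card (Poly_Mapping.keys \<beta>) = 1"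
      using that by (simp flip: size_exponents)
    then obtain i where i: "Poly_Mapping.keys \<beta> = {i}"
      by (auto simp: card_1_singleton_iff)
    with that have "Poly_Mapping.lookup \<beta> i = l"
      by (simp add: exponents_def)
    with i have "\<beta> = ?s i"
      by (intro poly_mapping_eqI) (metis in_keys_iff lookup_single_eq lookup_single_not_eq singletonD)
    then show ?thesis ..
  qed
  have split: "?s i + (\<alpha> - ?s i) = \<alpha>" if "l \<le> ?a i" for i
    using that by (intro poly_mapping_eqI) (auto simp: lookup_add lookup_minus lookup_single when_def)
  have rest: "exponents (\<alpha> - ?s i) = exponents \<alpha> - {#?a i#} + (if ?a i = l then {#} else {#?a i - l#})"
    if i: "i \<in> ?I" for i
  proof -
    have "Poly_Mapping.keys (\<alpha> - ?s i) \<subseteq> insert i (?k - {i})"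
      by (auto simp: in_keys_iff lookup_minus lookup_single when_def split: if_splits)
    then have "exponents (\<alpha> - ?s i) = filter_mset (\<lambda>b. b \<noteq> 0)
        (image_mset (Poly_Mapping.lookup (\<alpha> - ?s i)) (mset_set (insert i (?k - {i}))))"
      by (intro exponents_superset) simp_all
    also have "image_mset (Poly_Mapping.lookup (\<alpha> - ?s i)) (mset_set (insert i (?k - {i})))
        = add_mset (?a i - l) (image_mset ?a (mset_set (?k - {i})))"
      by (auto simp: lookup_minus lookup_single when_def simp del: insert_Diff_single intro!: image_mset_cong)
    also have "image_mset ?a (mset_set (?k - {i})) = exponents \<alpha> - {#?a i#}"
      using i by (simp add: exponents_def mset_set_Diff image_mset_Diff)
    also have "filter_mset (\<lambda>b. b \<noteq> 0) (add_mset (?a i - l) (exponents \<alpha> - {#?a i#}))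
        = exponents \<alpha> - {#?a i#} + (if ?a i = l then {#} else {#?a i - l#})"
    proof -
      have "0 \<notin># exponents \<alpha> - {#?a i#}"
        using zero_notin_exponents by (metis in_diffD)
      then show ?thesis
        using i filter_nonzero[OF zero_notin_exponents, of \<alpha>] by auto
    qed
    finally show ?thesis .
  qed
  have reindex: "(\<Sum>i\<in>?I. G (?a i)) = (\<Sum>b\<in>#filter_mset (\<lambda>b. l \<le> b) (exponents \<alpha>). G b)"
    for G :: "nat \<Rightarrow> ratfun"
    by (simp add: sum_unfold_sum_mset exponents_def filter_mset_image_mset multiset.map_comp comp_def filter_mset_mset_set)
  have "series_mult (mset_series {#l#}) (class_series F) \<alpha>
      = (\<Sum>p\<in>?D. (if exponents (fst p) = {#l#} then 1 else 0) * F (exponents (snd p)))"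
    by (simp add: series_mult_def mset_series_def class_series_def case_prod_beta)
  also have "\<dots> = (\<Sum>p\<in>?h ` ?I. F (exponents (snd p)))"
  proof (rule sum.mono_neutral_cong_right)
    show "?h ` ?I \<subseteq> ?D"
      using split by auto
    show "\<forall>p\<in>?D - ?h ` ?I. (if exponents (fst p) = {#l#} then 1 else 0) * F (exponents (snd p)) = 0"
    proof
      fix p assume p: "p \<in> ?D - ?h ` ?I"
      have "exponents (fst p) \<noteq> {#l#}"
      proof
        assume "exponents (fst p) = {#l#}"
        then obtain i where i: "fst p = ?s i"
          using single by blast
        with p have \<alpha>: "\<alpha> = ?s i + snd p"
          by auto
        then have "l \<le> ?a i"
          by (simp add: lookup_add)
        then have "i \<in> ?I"
          using l by (auto simp: in_keys_iff)
        moreover have "snd p = \<alpha> - ?s i"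
          using \<alpha> by simp
        ultimately have "p \<in> ?h ` ?I"
          using i by (intro image_eqI[of _ _ i]) (simp_all add: prod_eq_iff)
        with p show False
          by blast
      qed
      then show "(if exponents (fst p) = {#l#} then 1 else 0) * F (exponents (snd p)) = 0"
        by simp
    qed
  qed (auto simp: exp_single finite_decompositions)
  also have "\<dots> = (\<Sum>i\<in>?I. F (exponents (\<alpha> - ?s i)))"
  proof (subst sum.reindex)
    show "inj_on ?h ?I"
    proof (rule inj_onI)
      fix i j assume "?h i = ?h j"
      then have "Poly_Mapping.lookup (?s i) i = Poly_Mapping.lookup (?s j) i"
        by simp
      then show "i = j"
        using l by (simp add: lookup_single when_def split: if_splits)
    qed
  qed simp
  also have "\<dots> = (\<Sum>i\<in>?I. ?G (?a i))"
    by (rule sum.cong) (simp_all add: rest)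
  also have "\<dots> = (\<Sum>b\<in>#filter_mset (\<lambda>b. l \<le> b) (exponents \<alpha>). ?G b)"
    by (rule reindex)
  finally show "series_mult (mset_series {#l#}) (class_series F) \<alpha>
      = class_series (\<lambda>B. \<Sum>b\<in>#filter_mset (\<lambda>b. l \<le> b) B.
          F (B - {#b#} + (if b = l then {#} else {#b - l#}))) \<alpha>"
    by (simp add: class_series_def)
qed

section \<open>Evaluating the specialization on monomial symmetric functions\<close>

locale specialization =
  fixes \<phi> :: "series \<Rightarrow> ratfun"
  assumes spec: "is_specialization \<phi>"
begin

definition val :: "nat multiset \<Rightarrow> ratfun" where
  "val A = \<phi> (mset_series A)"

lemma \<phi>_add: "f \<in> Sym \<Longrightarrow> g \<in> Sym \<Longrightarrow> \<phi> (series_add f g) = \<phi> f + \<phi> g"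
  and \<phi>_mult: "f \<in> Sym \<Longrightarrow> g \<in> Sym \<Longrightarrow> \<phi> (series_mult f g) = \<phi> f * \<phi> g"
  and \<phi>_scale: "f \<in> Sym \<Longrightarrow> \<phi> (series_scale c f) = c * \<phi> f"
  and \<phi>_esym: "\<phi> (esym n) = q ^ (n choose 2) / fact n"
  using spec by (auto simp: is_specialization_def Sym_algebra_hom_def)

lemma val_esym: "val (replicate_mset n 1) = q ^ (n choose 2) / fact n"
  using \<phi>_esym[of n] by (simp only: val_def esym_eq_mset_series)

lemma val_empty: "val {#} = 1"
  using val_esym[of 0] by (simp add: numeral_2_eq_2)

text \<open>A homogeneous symmetric function is a finite linear combination of the m_A with A a
  partition of N. The truncation \<open>S X\<close> keeps the coefficients at exponent multisets in
  \<open>X\<close>, so enlarging \<open>X\<close> by one element adds one multiple of some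
  m_A.\<close>

lemma \<phi>_class_series:
  assumes "\<And>A. 0 \<notin># A \<Longrightarrow> F A \<noteq> 0 \<Longrightarrow> sum_mset A = N"
  shows "\<phi> (class_series F) = (\<Sum>A\<in>mset_partitions N. F A * val A)"
proof -
  define S where "S X = (\<lambda>\<alpha>. if exponents \<alpha> \<in> X then F (exponents \<alpha>) else 0)" for X
  have "S X \<in> Sym \<and> \<phi> (S X) = (\<Sum>A\<in>X. F A * val A)" if "finite X" for X
    using that
  proof (induction X)
    case empty
    \<comment> \<open>The zero series is written as a multiple with scalar 0, so that its value
      follows from homogeneity.\<close>
    have "S {} = series_scale 0 (mset_series {#})"
      by (simp add: S_def series_scale_def)
    then show ?case
      by (simp add: series_scale_Sym \<phi>_scale)
  next
    case (insert A X)
    have "S (insert A X) = series_add (series_scale (F A) (mset_series A)) (S X)"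
      using insert.hyps by (auto simp: S_def series_scale_def series_add_def mset_series_def class_series_def)
    then show ?case
      using insert by (simp add: series_scale_Sym series_add_Sym \<phi>_scale \<phi>_add val_def)
  qed
  moreover have "class_series F = S (mset_partitions N)"
    using assms[OF zero_notin_exponents]
    by (fastforce simp: S_def class_series_def exponents_in_mset_partitions sum_mset_exponents)
  ultimately show ?thesis
    using finite_mset_partitions by simp
qed

lemma one_part_product:
  assumes l: "l > 0"
    and F: "\<And>A. 0 \<notin># A \<Longrightarrow> F A \<noteq> 0 \<Longrightarrow> sum_mset A = N"
  shows "val {#l#} * (\<Sum>A\<in>mset_partitions N. F A * val A)
    = (\<Sum>B\<in>mset_partitions (N + l). (\<Sum>b\<in>#filter_mset (\<lambda>b. l \<le> b) B.
        F (B - {#b#} + (if b = l then {#} else {#b - l#}))) * val B)"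
proof -
  let ?H = "\<lambda>B. \<Sum>b\<in>#filter_mset (\<lambda>b. l \<le> b) B. F (B - {#b#} + (if b = l then {#} else {#b - l#}))"
  have "sum_mset B = N + l" if B: "0 \<notin># B" "?H B \<noteq> 0" for B
  proof -
    obtain b where b: "b \<in># filter_mset (\<lambda>b. l \<le> b) B" "F (B - {#b#} + (if b = l then {#} else {#b - l#})) \<noteq> 0"
      using B(2) by (metis (no_types, lifting) image_mset_cong sum_mset.neutral_const)
    then obtain C where C: "B = add_mset b C"
      by (auto dest: multi_member_split)
    have "sum_mset (B - {#b#} + (if b = l then {#} else {#b - l#})) = N"
      using b B(1) by (intro F) (auto simp: C)
    then show ?thesis
      using b(1) by (auto simp: C split: if_splits)
  qed
  then have "\<phi> (class_series ?H) = (\<Sum>B\<in>mset_partitions (N + l). ?H B * val B)"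
    by (intro \<phi>_class_series) blast
  moreover have "class_series F \<in> Sym"
    using F by (intro class_series_Sym[of _ N]) force
  ultimately show ?thesis
    using \<phi>_class_series[of F N] F
    by (simp add: \<phi>_mult val_def flip: series_mult_one_part[OF l])
qed

end

section \<open>Recurrences from power sum products\<close>

lemma sum_mset_image_count:
  fixes f :: "'a \<Rightarrow> 'b::comm_semiring_1"
  shows "(\<Sum>x\<in>#A. f x) = (\<Sum>x\<in>set_mset A. of_nat (count A x) * f x)"
proof (induction A)
  case (add a A)
  let ?S = "set_mset A - {a}"
  have *: "(\<Sum>x\<in>set_mset B. of_nat (count B x) * f x)
      = of_nat (count B a) * f a + (\<Sum>x\<in>?S. of_nat (count A x) * f x)"
    if "set_mset B - {a} = ?S" "\<And>x. x \<noteq> a \<Longrightarrow> count B x = count A x" for B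
  proof -
    have "(\<Sum>x\<in>set_mset B. of_nat (count B x) * f x) = (\<Sum>x\<in>insert a ?S. of_nat (count B x) * f x)"
      using that(1) by (intro sum.mono_neutral_left) (auto simp: not_in_iff)
    then show ?thesis
      using that(2) by (simp del: insert_Diff_single)
  qed
  show ?case
    using add *[of A] *[of "add_mset a A"] by (simp add: algebra_simps)
qed simp

lemma sum_mset_filter:
  fixes f :: "'a \<Rightarrow> 'b::comm_monoid_add"
  shows "(\<Sum>x\<in>#filter_mset P A. f x) = (\<Sum>x\<in>#A. if P x then f x else 0)"
  by (induction A) auto

lemma sum_sum_mset_swap:
  fixes f :: "'a \<Rightarrow> 'b \<Rightarrow> 'c::comm_monoid_add"
  shows "(\<Sum>l\<in>L. \<Sum>b\<in>#B. f l b) = (\<Sum>b\<in>#B. \<Sum>l\<in>L. f l b)"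
  by (induction B) (simp_all add: sum.distrib)

definition mset_mult_fact :: "nat multiset \<Rightarrow> nat" where
  "mset_mult_fact A = (\<Prod>k\<in>set_mset A. fact (count A k))"

lemma mult_fact_eq: "mult_fact la = mset_mult_fact (mset la)"
  by (simp add: mult_fact_def mset_mult_fact_def count_mset)

lemma mset_mult_fact_add:
  "mset_mult_fact (add_mset x A) = Suc (count A x) * mset_mult_fact A"
proof -
  let ?S = "set_mset A - {x}"
  have "mset_mult_fact B = fact (count B x) * (\<Prod>k\<in>?S. fact (count A k))"
    if "set_mset B - {x} = ?S" "\<And>y. y \<noteq> x \<Longrightarrow> count B y = count A y" for B
  proof -
    have "mset_mult_fact B = (\<Prod>k\<in>insert x ?S. fact (count B k))"
      unfolding mset_mult_fact_def using that(1) by (intro prod.mono_neutral_left) (auto simp: not_in_iff)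
    then show ?thesis
      using that(2) by (simp del: insert_Diff_single)
  qed
  from this[of A] this[of "add_mset x A"] show ?thesis
    by (simp add: algebra_simps)
qed

lemma mset_mult_fact_pos: "mset_mult_fact A > 0"
  by (simp add: mset_mult_fact_def)

context specialization
begin

text \<open>The multiples \<open>m(\<mu>)! m\<^sub>\<mu>\<close> satisfy a product rule without multiplicities.\<close>

definition aug :: "nat multiset \<Rightarrow> ratfun" where
  "aug A = of_nat (mset_mult_fact A) * val A"

text \<open>The coefficient of m_C in p_l m_\<mu>, where C arises from \<mu> by raising a part c to
  c + l, is the multiplicity of c + l in C. Multiplied by m(\<mu>)! it equals the multiplicity of c
  in \<mu> times m(C)!, so in terms of \<open>aug\<close> each part of \<mu> contributes one term
  with coefficient 1.\<close>

lemma one_part_product_aug: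
  assumes l: "l > 0" and \<mu>: "0 \<notin># \<mu>"
  shows "val {#l#} * aug \<mu> = aug (add_mset l \<mu>) + (\<Sum>c\<in>#\<mu>. aug (add_mset (c + l) (\<mu> - {#c#})))"
proof -
  \<comment> \<open>Since 0 is not in \<mu>, the index c = 0 removes nothing and yields \<mu> with
    the new part l. Appending a part is thus treated as raising an empty one.\<close>
  define B where "B c = add_mset (c + l) (\<mu> - {#c#})" for c
  let ?N = "sum_mset \<mu>" and ?m = "\<lambda>A. of_nat (mset_mult_fact A) :: ratfun"
  let ?red = "\<lambda>C b. C - {#b#} + (if b = l then {#} else {#b - l#})"
  let ?S = "insert 0 (set_mset \<mu>)"
  let ?P = "mset_partitions (?N + l)"
  have B0: "B 0 = add_mset l \<mu>"
    using \<mu> by (simp add: B_def)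
  have "(\<Sum>A\<in>mset_partitions ?N. (if A = \<mu> then 1 else 0) * val A) = (\<Sum>A\<in>mset_partitions ?N. if A = \<mu> then val A else 0)"
    by (intro sum.cong) auto
  also have "\<dots> = val \<mu>"
  proof -
    have "\<mu> \<in> mset_partitions ?N"
      using \<mu> by (simp add: mset_partitions_def)
    then show ?thesis
      by (simp add: finite_mset_partitions)
  qed
  finally have "val {#l#} * val \<mu> = (\<Sum>C\<in>?P.
      (\<Sum>b\<in>#filter_mset (\<lambda>b. l \<le> b) C. if ?red C b = \<mu> then 1 else 0) * val C)"
    using one_part_product[OF l, of "\<lambda>A. if A = \<mu> then 1 else 0" ?N] by (simp split: if_splits)
  also have "\<dots> = (\<Sum>C\<in>?P. \<Sum>b\<in>set_mset C.
      of_nat (count C b) * (if l \<le> b \<and> ?red C b = \<mu> then 1 else 0) * val C)"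
    unfolding sum_mset_filter unfolding sum_mset_image_count sum_distrib_right by (intro sum.cong) auto
  also have "\<dots> = (\<Sum>(C, b)\<in>Sigma ?P set_mset.
      of_nat (count C b) * (if l \<le> b \<and> ?red C b = \<mu> then 1 else 0) * val C)"
    by (intro sum.Sigma) (simp_all add: finite_mset_partitions)
  \<comment> \<open>Lowering b by l in C gives \<mu> exactly for the pairs (\<open>B c\<close>, c +
    l), where c = b - l.\<close>
  also have "\<dots> = (\<Sum>(C, b)\<in>(\<lambda>c. (B c, c + l)) ` ?S. of_nat (count C b) * val C)"
  proof (rule sum.mono_neutral_cong_right)
    show "finite (Sigma ?P set_mset)"
      by (simp add: finite_mset_partitions)
    have "B c \<in> ?P" if "c \<in> ?S" for c
      using that l \<mu> by (auto simp: B_def mset_partitions_def dest!: multi_member_split)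
    then show "(\<lambda>c. (B c, c + l)) ` ?S \<subseteq> Sigma ?P set_mset"
      by (intro image_subsetI SigmaI) (simp_all add: B_def)
    have "p \<in> (\<lambda>c. (B c, c + l)) ` ?S"
      if p: "p \<in> Sigma ?P set_mset" "l \<le> snd p" "?red (fst p) (snd p) = \<mu>" for p
    proof (rule image_eqI)
      obtain C where C: "fst p = add_mset (snd p) C"
        using p(1) by (auto dest: multi_member_split)
      show "snd p - l \<in> ?S"
        using p(2,3) by (auto split: if_splits)
      show "p = (B (snd p - l), snd p - l + l)"
        using p(2,3) \<mu> C by (auto simp: B_def prod_eq_iff split: if_splits)
    qed
    then have "(if l \<le> snd p \<and> ?red (fst p) (snd p) = \<mu> then 1 else 0) = (0 :: ratfun)"
      if "p \<in> Sigma ?P set_mset - (\<lambda>c. (B c, c + l)) ` ?S" for p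
      using that by (intro if_not_P) blast
    then show "\<forall>p\<in>Sigma ?P set_mset - (\<lambda>c. (B c, c + l)) ` ?S. (case p of (C, b) \<Rightarrow>
        of_nat (count C b) * (if l \<le> b \<and> ?red C b = \<mu> then 1 else 0) * val C) = 0"
      by (intro ballI) (simp only: case_prod_beta mult_zero_left mult_zero_right)
    have "?red (B c) (c + l) = \<mu>" if "c \<in> ?S" for c
      using that \<mu> by (auto simp: B_def dest!: multi_member_split)
    from this show "\<And>p. p \<in> (\<lambda>c. (B c, c + l)) ` ?S \<Longrightarrow> (case p of (C, b) \<Rightarrow>
        of_nat (count C b) * (if l \<le> b \<and> ?red C b = \<mu> then 1 else 0) * val C)
        = (case p of (C, b) \<Rightarrow> of_nat (count C b) * val C)"
      by (elim imageE) (simp only: case_prod_conv le_add2 if_True simp_thms mult_1_right)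
  qed
  also have "\<dots> = (\<Sum>c\<in>?S. of_nat (count (B c) (c + l)) * val (B c))"
    by (subst sum.reindex) (auto intro!: inj_onI)
  also have "\<dots> = of_nat (count (B 0) l) * val (B 0) + (\<Sum>c\<in>set_mset \<mu>. of_nat (count (B c) (c + l)) * val (B c))"
    using \<mu> by simp
  finally have "val {#l#} * aug \<mu> = (?m \<mu> * of_nat (count (B 0) l)) * val (B 0)
      + (\<Sum>c\<in>set_mset \<mu>. (?m \<mu> * of_nat (count (B c) (c + l))) * val (B c))"
    by (simp add: aug_def algebra_simps sum_distrib_left)
  also have "?m \<mu> * of_nat (count (B 0) l) = ?m (B 0)"
    unfolding B0 mset_mult_fact_add by (simp add: algebra_simps)
  also have "(\<Sum>c\<in>set_mset \<mu>. (?m \<mu> * of_nat (count (B c) (c + l))) * val (B c))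
      = (\<Sum>c\<in>set_mset \<mu>. of_nat (count \<mu> c) * aug (B c))"
  proof (rule sum.cong[OF refl])
    fix c assume "c \<in> set_mset \<mu>"
    then obtain \<nu> where \<nu>: "\<mu> = add_mset c \<nu>"
      by (blast dest: multi_member_split)
    have "mset_mult_fact \<mu> * count (B c) (c + l) = count \<mu> c * mset_mult_fact (B c)"
      by (simp add: \<nu> B_def mset_mult_fact_add algebra_simps)
    then have "?m \<mu> * of_nat (count (B c) (c + l)) = of_nat (count \<mu> c) * ?m (B c)"
      by (metis of_nat_mult)
    then show "(?m \<mu> * of_nat (count (B c) (c + l))) * val (B c) = of_nat (count \<mu> c) * aug (B c)"
      by (simp add: aug_def)
  qed
  also have "\<dots> = (\<Sum>c\<in>#\<mu>. aug (B c))"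
    by (rule sum_mset_image_count[symmetric])
  finally show ?thesis
    using \<mu> by (simp add: aug_def B_def)
qed

text \<open>Shared form of the two recurrences below, for sums of c_l p_l f_l with f_l homogeneous
  of degree N - l. After exchanging the sums, each partition B of N and each part b of B leaves a
  sum over l \<le> b that can be evaluated on its own.\<close>

lemma one_part_products_combine:
  assumes "\<And>l A. l \<in> {1..N} \<Longrightarrow> 0 \<notin># A \<Longrightarrow> F l A \<noteq> 0 \<Longrightarrow> sum_mset A = N - l"
  shows "(\<Sum>l=1..N. c l * (val {#l#} * (\<Sum>A\<in>mset_partitions (N - l). F l A * val A)))
    = (\<Sum>B\<in>mset_partitions N. (\<Sum>b\<in>#B. \<Sum>l\<in>{l\<in>{1..N}. l \<le> b}.
        c l * F l (B - {#b#} + (if b = l then {#} else {#b - l#}))) * val B)"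
proof -
  let ?f = "\<lambda>B l b. c l * F l (B - {#b#} + (if b = l then {#} else {#b - l#}))"
  have "(\<Sum>l=1..N. c l * (val {#l#} * (\<Sum>A\<in>mset_partitions (N - l). F l A * val A)))
    = (\<Sum>l=1..N. \<Sum>B\<in>mset_partitions N. (\<Sum>b\<in>#B. if l \<le> b then ?f B l b else 0) * val B)"
  proof (rule sum.cong[OF refl])
    fix l assume l: "l \<in> {1..N}"
    then have "val {#l#} * (\<Sum>A\<in>mset_partitions (N - l). F l A * val A)
      = (\<Sum>B\<in>mset_partitions N. (\<Sum>b\<in>#filter_mset (\<lambda>b. l \<le> b) B.
          F l (B - {#b#} + (if b = l then {#} else {#b - l#}))) * val B)"
      using one_part_product[of l "F l" "N - l"] assms by simp
    moreover have "c l * (\<Sum>b\<in>#filter_mset (\<lambda>b. l \<le> b) B.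
          F l (B - {#b#} + (if b = l then {#} else {#b - l#}))) = (\<Sum>b\<in>#B. if l \<le> b then ?f B l b else 0)" for B
      unfolding sum_mset_filter sum_mset_distrib_left
      by (intro arg_cong[of _ _ sum_mset] image_mset_cong) auto
    ultimately show "c l * (val {#l#} * (\<Sum>A\<in>mset_partitions (N - l). F l A * val A))
      = (\<Sum>B\<in>mset_partitions N. (\<Sum>b\<in>#B. if l \<le> b then ?f B l b else 0) * val B)"
      by (simp add: sum_distrib_left flip: mult.assoc)
  qed
  also have "\<dots> = (\<Sum>B\<in>mset_partitions N. (\<Sum>l=1..N. \<Sum>b\<in>#B. if l \<le> b then ?f B l b else 0) * val B)"
    by (subst sum.swap) (simp add: sum_distrib_right)
  also have "\<dots> = (\<Sum>B\<in>mset_partitions N. (\<Sum>b\<in>#B. \<Sum>l\<in>{l\<in>{1..N}. l \<le> b}. ?f B l b) * val B)"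
    unfolding sum_sum_mset_swap by (simp only: sum.inter_filter finite_atLeastAtMost)
  finally show ?thesis .
qed

lemma mset_partitions_part_le: "B \<in> mset_partitions N \<Longrightarrow> b \<in># B \<Longrightarrow> b \<le> N \<and> 0 < b"
  by (auto simp: mset_partitions_def dest!: multi_member_split)

text \<open>Here e_k is m of (1^k). At B, a part b = 1 admits only l = 1 and contributes 1 precisely
  when all parts are 1; there are N such parts. For a part b \<ge> 2 only l = b - 1 and l = b can
  leave a partition with all parts 1. Both do so under the same condition on the other parts, and
  their signs are opposite.\<close>

lemma newton_identity:
  "of_nat N * val (replicate_mset N 1)
     = (\<Sum>l=1..N. (-1) ^ (l - 1) * (val {#l#} * val (replicate_mset (N - l) 1)))"
proof -
  let ?F = "\<lambda>l A. if A = replicate_mset (N - l) 1 then 1 else 0 :: ratfun"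
  have inner: "(\<Sum>l\<in>{l\<in>{1..N}. l \<le> b}. (-1) ^ (l - 1) * ?F l (B - {#b#} + (if b = l then {#} else {#b - l#})))
      = (if B = replicate_mset N 1 then 1 else 0)"
    if B: "B \<in> mset_partitions N" and b: "b \<in># B" for B b
  proof -
    obtain C where C: "B = add_mset b C"
      using b by (blast dest: multi_member_split)
    have bN: "b \<le> N" "0 < b"
      using mset_partitions_part_le[OF B b] by auto
    show ?thesis
    proof (cases "b = 1")
      case True
      then have "{l\<in>{1..N}. l \<le> b} = {1}"
        using bN by auto
      moreover obtain M where "N = Suc M"
        using bN by (cases N) auto
      ultimately show ?thesis
        using True by (simp add: C)
    next
      case False
      then obtain k where k: "b = Suc (Suc k)"
        using bN by (metis One_nat_def gr0_conv_Suc not_gr_zero)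
      have "(\<Sum>l\<in>{l\<in>{1..N}. l \<le> b}. (-1) ^ (l - 1) * ?F l (B - {#b#} + (if b = l then {#} else {#b - l#})))
          = (\<Sum>l\<in>{Suc k, Suc (Suc k)}. (-1) ^ (l - 1) * ?F l (B - {#b#} + (if b = l then {#} else {#b - l#})))"
      proof (rule sum.mono_neutral_right)
        show "\<forall>l\<in>{l\<in>{1..N}. l \<le> b} - {Suc k, Suc (Suc k)}.
            (-1) ^ (l - 1) * ?F l (B - {#b#} + (if b = l then {#} else {#b - l#})) = 0"
        proof
          fix l assume l: "l \<in> {l\<in>{1..N}. l \<le> b} - {Suc k, Suc (Suc k)}"
          then have "l < Suc k"
            using k by auto
          then have "b \<noteq> l" "b - l \<noteq> 1"
            using k by auto
          then have "add_mset (b - l) C \<noteq> replicate_mset (N - l) 1"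
            by (metis in_replicate_mset union_single_eq_member)
          then show "(-1) ^ (l - 1) * ?F l (B - {#b#} + (if b = l then {#} else {#b - l#})) = 0"
            using \<open>b \<noteq> l\<close> by (simp add: C)
        qed
      qed (use bN k in auto)
      also have "\<dots> = 0"
      proof -
        have "N - Suc k = Suc (N - Suc (Suc k))"
          using bN k by simp
        then show ?thesis
          by (simp add: C k)
      qed
      finally show ?thesis
        using b False by (auto split: if_splits)
    qed
  qed
  have delta: "(\<Sum>A\<in>mset_partitions M. (if A = replicate_mset M 1 then 1 else 0) * g A) = g (replicate_mset M 1)"
    for M and g :: "nat multiset \<Rightarrow> ratfun"
  proof -
    have "(\<Sum>A\<in>mset_partitions M. (if A = replicate_mset M 1 then 1 else 0) * g A)
        = (\<Sum>A\<in>mset_partitions M. if A = replicate_mset M 1 then g A else 0)"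
      by (intro sum.cong) auto
    also have "\<dots> = g (replicate_mset M 1)"
      by (simp add: finite_mset_partitions) (simp add: mset_partitions_def)
    finally show ?thesis .
  qed
  have "(\<Sum>l=1..N. (-1) ^ (l - 1) * (val {#l#} * val (replicate_mset (N - l) 1)))
      = (\<Sum>l=1..N. (-1) ^ (l - 1) * (val {#l#} * (\<Sum>A\<in>mset_partitions (N - l). ?F l A * val A)))"
    by (simp only: delta)
  also have "\<dots> = (\<Sum>B\<in>mset_partitions N. (\<Sum>b\<in>#B. \<Sum>l\<in>{l\<in>{1..N}. l \<le> b}.
        (-1) ^ (l - 1) * ?F l (B - {#b#} + (if b = l then {#} else {#b - l#}))) * val B)"
    by (rule one_part_products_combine) (auto split: if_splits)
  also have "\<dots> = (\<Sum>B\<in>mset_partitions N. (\<Sum>b\<in>#B. if B = replicate_mset N 1 then 1 else 0) * val B)"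
    by (intro sum.cong refl arg_cong2[of _ _ _ _ "(*)"] arg_cong[of _ _ sum_mset] image_mset_cong) (rule inner)
  also have "\<dots> = (\<Sum>B\<in>mset_partitions N. (if B = replicate_mset N 1 then 1 else 0) * (of_nat (size B) * val B))"
    by (intro sum.cong) auto
  also have "\<dots> = of_nat N * val (replicate_mset N 1)"
    by (simp only: delta size_replicate_mset)
  finally show ?thesis ..
qed

text \<open>The image of the coefficient of t^N in the product over i of (1 - q x_i t) / (1 - x_i
  t), that is, of the Hall-Littlewood function q_N(x; q).\<close>

definition length_sum :: "nat \<Rightarrow> ratfun" where
  "length_sum N = (\<Sum>A\<in>mset_partitions N. (1 - q) ^ size A * val A)"

text \<open>The logarithmic derivative of that product is the sum of (1 - q^l) p_l t^(l-1). In
  coefficients: for a part b of B, the terms with l < b keep the number r of parts and l = b lowers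
  it by one. As (1 - q^b) / (1 - q) = 1 + q + ... + q^(b-1), they add up to b (1 - q)^r, and summing
  over the parts gives N (1 - q)^r.\<close>

lemma length_sum_rec:
  "of_nat N * length_sum N = (\<Sum>l=1..N. (1 - q ^ l) * (val {#l#} * length_sum (N - l)))"
proof -
  let ?F = "\<lambda>l A. if sum_mset A = N - l then (1 - q) ^ size A else 0"
  have inner: "(\<Sum>l\<in>{l\<in>{1..N}. l \<le> b}. (1 - q ^ l) * ?F l (B - {#b#} + (if b = l then {#} else {#b - l#})))
      = of_nat b * (1 - q) ^ size B"
    if B: "B \<in> mset_partitions N" and b: "b \<in># B" for B b
  proof -
    obtain C where C: "B = add_mset b C"
      using b by (blast dest: multi_member_split)
    have bN: "b \<le> N" "0 < b"
      using mset_partitions_part_le[OF B b] by auto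
    have N: "N = b + sum_mset C"
      using B by (simp add: mset_partitions_def C)
    obtain k where k: "b = Suc k"
      using bN by (auto dest: gr0_implies_Suc)
    have "{l\<in>{1..N}. l \<le> b} = insert (Suc k) {1..k}"
      using bN k by auto
    moreover have "?F l (B - {#b#} + (if b = l then {#} else {#b - l#})) = (1 - q) ^ (if b = l then size C else size B)"
      if "l \<le> b" for l
      using that N by (simp add: C add.commute)
    ultimately have "(\<Sum>l\<in>{l\<in>{1..N}. l \<le> b}. (1 - q ^ l) * ?F l (B - {#b#} + (if b = l then {#} else {#b - l#})))
      = (\<Sum>l\<in>insert (Suc k) {1..k}. (1 - q ^ l) * (1 - q) ^ (if b = l then size C else size B))"
      by (intro sum.cong arg_cong2[of _ _ _ _ "(*)"]) blast+
    also have "\<dots> = (1 - q ^ Suc k) * (1 - q) ^ size C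
        + (\<Sum>l=1..k. (1 - q ^ l) * (1 - q) ^ (if b = l then size C else size B))"
      using k by (subst sum.insert) auto
    also have "(\<Sum>l=1..k. (1 - q ^ l) * (1 - q) ^ (if b = l then size C else size B))
        = (\<Sum>l=1..k. (1 - q ^ l) * (1 - q) ^ size B)"
      using k by (intro sum.cong) auto
    also have "1 - q ^ Suc k = (1 - q) * (\<Sum>l\<le>k. q ^ l)"
      by (simp only: one_diff_power_eq lessThan_Suc_atMost)
    also have "(\<Sum>l\<le>k. q ^ l) = 1 + (\<Sum>l=1..k. q ^ l)"
      by (simp add: atMost_atLeast0 sum.atLeast_Suc_atMost)
    finally show ?thesis
      by (simp add: C k algebra_simps sum_subtractf sum.distrib flip: sum_distrib_right sum_distrib_left)
  qed
  have "length_sum M = (\<Sum>A\<in>mset_partitions M. (if sum_mset A = M then (1 - q) ^ size A else 0) * val A)" for M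
    unfolding length_sum_def by (intro sum.cong) (auto simp: mset_partitions_def)
  then have "(\<Sum>l=1..N. (1 - q ^ l) * (val {#l#} * length_sum (N - l)))
      = (\<Sum>l=1..N. (1 - q ^ l) * (val {#l#} * (\<Sum>A\<in>mset_partitions (N - l). ?F l A * val A)))"
    by simp
  also have "\<dots> = (\<Sum>B\<in>mset_partitions N. (\<Sum>b\<in>#B. \<Sum>l\<in>{l\<in>{1..N}. l \<le> b}.
        (1 - q ^ l) * ?F l (B - {#b#} + (if b = l then {#} else {#b - l#}))) * val B)"
    by (rule one_part_products_combine) (auto split: if_splits)
  also have "\<dots> = (\<Sum>B\<in>mset_partitions N. (\<Sum>b\<in>#B. of_nat b * (1 - q) ^ size B) * val B)"
    by (intro sum.cong refl arg_cong2[of _ _ _ _ "(*)"] arg_cong[of _ _ sum_mset] image_mset_cong) (rule inner)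
  also have "\<dots> = (\<Sum>B\<in>mset_partitions N. of_nat N * ((1 - q) ^ size B * val B))"
  proof (rule sum.cong[OF refl])
    fix B assume "B \<in> mset_partitions N"
    then have "(\<Sum>b\<in>#B. of_nat b) = (of_nat N :: ratfun)"
      by (simp add: mset_partitions_def flip: of_nat_sum_mset)
    then show "(\<Sum>b\<in>#B. of_nat b * (1 - q) ^ size B) * val B = of_nat N * ((1 - q) ^ size B * val B)"
      by (simp flip: sum_mset_distrib_right)
  qed
  finally show ?thesis
    by (simp add: length_sum_def sum_distrib_left)
qed

end

section \<open>The one-row polynomials\<close>

lemma q_nonzero [simp]: "q \<noteq> 0"
  by (simp add: q_def)

lemma q_neq_1 [simp]: "q \<noteq> 1" "1 \<noteq> q"
proof -
  have "to_fract [:0, 1:] \<noteq> (to_fract 1 :: ratfun)"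
    unfolding to_fract_eq_iff by (simp add: one_pCons)
  then show "q \<noteq> 1" "1 \<noteq> q"
    by (auto simp: q_def)
qed

section \<open>The subring of integer polynomials in Q(q)\<close>

lemma of_int_poly_q_simps [simp]:
  "of_int_poly_q 0 = 0" "of_int_poly_q 1 = 1"
  "of_int_poly_q (a + b) = of_int_poly_q a + of_int_poly_q b"
  "of_int_poly_q (a - b) = of_int_poly_q a - of_int_poly_q b"
  "of_int_poly_q (a * b) = of_int_poly_q a * of_int_poly_q b"
  by (simp_all add: of_int_poly_q_def poly_eq_iff coeff_map_poly coeff_mult
      flip: to_fract_add to_fract_diff to_fract_mult)

lemma of_int_poly_q_inject [simp]: "of_int_poly_q a = of_int_poly_q b \<longleftrightarrow> a = b"
  by (auto simp: of_int_poly_q_def poly_eq_iff coeff_map_poly)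

lemma of_int_poly_q_X: "of_int_poly_q [:0, 1:] = q"
  by (simp add: of_int_poly_q_def q_def map_poly_pCons)

definition int_polys :: "ratfun set" where
  "int_polys = range of_int_poly_q"

lemma int_polys_add: "x \<in> int_polys \<Longrightarrow> y \<in> int_polys \<Longrightarrow> x + y \<in> int_polys"
  unfolding int_polys_def by (metis (no_types, lifting) of_int_poly_q_simps(3) image_iff rangeI)

lemma int_polys_diff: "x \<in> int_polys \<Longrightarrow> y \<in> int_polys \<Longrightarrow> x - y \<in> int_polys"
  unfolding int_polys_def by (metis (no_types, lifting) of_int_poly_q_simps(4) image_iff rangeI)

lemma int_polys_mult: "x \<in> int_polys \<Longrightarrow> y \<in> int_polys \<Longrightarrow> x * y \<in> int_polys"
  unfolding int_polys_def by (metis (no_types, lifting) of_int_poly_q_simps(5) image_iff rangeI)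

lemma int_polys_0: "0 \<in> int_polys"
  unfolding int_polys_def by (metis of_int_poly_q_simps(1) rangeI)

lemma int_polys_1: "1 \<in> int_polys"
  unfolding int_polys_def by (metis of_int_poly_q_simps(2) rangeI)

lemma int_polys_q: "q \<in> int_polys"
  unfolding int_polys_def by (metis of_int_poly_q_X rangeI)

lemma int_polys_sum: "(\<And>i. i \<in> I \<Longrightarrow> f i \<in> int_polys) \<Longrightarrow> sum f I \<in> int_polys"
  by (induction I rule: infinite_finite_induct) (auto simp: int_polys_add int_polys_0)

lemma int_polys_power: "x \<in> int_polys \<Longrightarrow> x ^ n \<in> int_polys"
  by (induction n) (auto simp: int_polys_mult int_polys_1)

lemma int_polys_of_nat: "of_nat n \<in> int_polys"
  by (induction n) (auto simp: int_polys_add int_polys_0 int_polys_1)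

section \<open>Dilation of power series and a Riccati equation\<close>

definition fps_dilate :: "'a::field \<Rightarrow> 'a fps \<Rightarrow> 'a fps" where
  "fps_dilate c f = Abs_fps (\<lambda>n. c ^ n * f $ n)"

lemma fps_dilate_mult: "fps_dilate c (f * g) = fps_dilate c f * fps_dilate c g"
proof (rule fps_ext)
  fix n
  have "c ^ n * (f $ i * g $ (n - i)) = (c ^ i * f $ i) * (c ^ (n - i) * g $ (n - i))" if "i \<in> {0..n}" for i
    using that by (simp flip: power_add)
  then have "(\<Sum>i=0..n. c ^ n * (f $ i * g $ (n - i))) = (\<Sum>i=0..n. (c ^ i * f $ i) * (c ^ (n - i) * g $ (n - i)))"
    by (rule sum.cong[OF refl])
  then show "fps_dilate c (f * g) $ n = (fps_dilate c f * fps_dilate c g) $ n"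
    by (simp add: fps_dilate_def fps_mult_nth sum_distrib_left)
qed

lemma fps_deriv_dilate: "fps_deriv (fps_dilate c f) = fps_const c * fps_dilate c (fps_deriv f)"
  by (rule fps_ext) (simp add: fps_dilate_def)

text \<open>If \<open>E' = P E\<close> and \<open>E'(t) = E(c t)\<close>, differentiate \<open>P(t) E(t) = E(c t)\<close>.\<close>

lemma fps_dilation_riccati:
  assumes "fps_deriv E = P * E" "fps_deriv E = fps_dilate c E" "E \<noteq> 0"
  shows "fps_deriv P = (fps_const c * fps_dilate c P - P) * P"
proof -
  have "fps_deriv P * E + P * (P * E) = fps_deriv (fps_deriv E)"
    using assms(1) by simp
  also have "\<dots> = fps_const c * fps_dilate c (fps_deriv E)"
    unfolding assms(2) by (simp add: fps_deriv_dilate assms(2))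
  also have "\<dots> = fps_const c * (fps_dilate c P * (P * E))"
    using assms(1,2) by (simp add: fps_dilate_mult)
  finally have "fps_deriv P * E = ((fps_const c * fps_dilate c P - P) * P) * E"
    by (simp add: algebra_simps)
  then show ?thesis
    using assms(3) by simp
qed

context specialization
begin

text \<open>The coefficient of t^n in P'(t) = (q P(q t) - P(t)) P(t), where P is the signed
  generating function of the power sums; the common sign (-1)^(n+1) cancels.\<close>

lemma power_sum_rec:
  "of_nat (Suc n) * val {#Suc (Suc n)#}
     = (\<Sum>i\<le>n. (1 - q ^ Suc i) * (val {#Suc i#} * val {#Suc (n - i)#}))"
proof -
  define E where "E = Abs_fps (\<lambda>n. val (replicate_mset n 1))"
  \<comment> \<open>The alternating signs absorb those of Newton's identities, which become E' = P
    E.\<close>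
  define P where "P = Abs_fps (\<lambda>n. (-1) ^ n * val {#Suc n#})"
  have E_nth: "E $ n = q ^ (n choose 2) / fact n" for n
    unfolding E_def by (simp only: fps_nth_Abs_fps val_esym)
  have 1: "fps_deriv E = P * E"
  proof (rule fps_ext)
    fix n
    have "fps_deriv E $ n = (\<Sum>l=1..Suc n. (-1) ^ (l - 1) * (val {#l#} * val (replicate_mset (Suc n - l) 1)))"
      using newton_identity[of "Suc n"] by (simp add: E_def)
    also have "\<dots> = (\<Sum>l=0..n. (-1) ^ l * (val {#Suc l#} * val (replicate_mset (n - l) 1)))"
      unfolding One_nat_def sum.shift_bounds_cl_Suc_ivl by simp
    finally show "fps_deriv E $ n = (P * E) $ n"
      by (simp add: E_def P_def fps_mult_nth mult.assoc)
  qed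
  \<comment> \<open>This is where the particular specialization enters: binom(n+1, 2) = n + binom(n,
    2), while the factor n + 1 from the derivative turns 1/(n+1)! into 1/n!.\<close>
  have 2: "fps_deriv E = fps_dilate q E"
  proof (rule fps_ext)
    fix n
    have "(Suc n choose 2) = n + (n choose 2)"
      by (simp add: numeral_2_eq_2)
    moreover have "of_nat (Suc n) * (x / fact (Suc n)) = x / (fact n :: ratfun)" for x
      by (simp only: fact_Suc of_nat_mult mult_divide_mult_cancel_left_if times_divide_eq_right) (simp del: of_nat_Suc)
    ultimately show "fps_deriv E $ n = fps_dilate q E $ n"
      by (simp add: E_nth fps_dilate_def power_add del: of_nat_Suc fact_Suc)
  qed
  have "E $ 0 \<noteq> 0"
    by (simp add: E_nth)
  then have "E \<noteq> 0"
    by auto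
  have "fps_deriv P $ n = (\<Sum>i=0..n. (fps_const q * fps_dilate q P - P) $ i * P $ (n - i))"
    unfolding fps_dilation_riccati[OF 1 2 \<open>E \<noteq> 0\<close>] by (intro fps_mult_nth)
  also have "\<dots> = (\<Sum>i=0..n. (q * (q ^ i * P $ i) - P $ i) * P $ (n - i))"
    by (simp add: fps_dilate_def)
  finally have "fps_deriv P $ n = (\<Sum>i=0..n. (q * (q ^ i * P $ i) - P $ i) * P $ (n - i))" .
  moreover have "fps_deriv P $ n = - ((-1) ^ n * (of_nat (Suc n) * val {#Suc (Suc n)#}))"
    by (simp add: P_def)
  ultimately have "(-1) ^ n * (of_nat (Suc n) * val {#Suc (Suc n)#})
      = - (\<Sum>i=0..n. (q * (q ^ i * P $ i) - P $ i) * P $ (n - i))"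
    by (metis minus_minus)
  also have "\<dots> = (\<Sum>i=0..n. (-1) ^ n * ((1 - q ^ Suc i) * (val {#Suc i#} * val {#Suc (n - i)#})))"
  proof (unfold sum_negf[symmetric], rule sum.cong[OF refl])
    fix i assume "i \<in> {0..n}"
    then have "(-1) ^ n = (-1) ^ i * ((-1) ^ (n - i) :: ratfun)"
      by (simp flip: power_add)
    then show "- ((q * (q ^ i * P $ i) - P $ i) * P $ (n - i))
        = (-1) ^ n * ((1 - q ^ Suc i) * (val {#Suc i#} * val {#Suc (n - i)#}))"
      by (simp add: P_def algebra_simps)
  qed
  finally show ?thesis
    by (simp add: atMost_atLeast0 flip: sum_distrib_left)
qed

lemma val_1: "val {#Suc 0#} = 1"
  using val_esym[of 1] by (simp add: numeral_2_eq_2)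

text \<open>Both sides are 1 for n = 0. With l = i + 1 and the induction hypothesis applied to the
  last factor, \<open>length_sum_rec\<close> has the same right-hand side as
  \<open>power_sum_rec\<close>.\<close>

lemma val_eq_length_sum: "val {#Suc n#} = length_sum n"
proof (induction n rule: less_induct)
  case (less n)
  show ?case
  proof (cases n)
    case 0
    have "mset_partitions 0 = {{#}}"
      by (auto simp: mset_partitions_def intro: multiset_nonemptyE)
    then show ?thesis
      using 0 by (simp add: val_1 length_sum_def val_empty)
  next
    case (Suc m)
    have "of_nat n * length_sum n = (\<Sum>l=Suc 0..Suc m. (1 - q ^ l) * (val {#l#} * length_sum (n - l)))"
      using length_sum_rec[of n] Suc by simp
    also have "\<dots> = (\<Sum>i=0..m. (1 - q ^ Suc i) * (val {#Suc i#} * length_sum (m - i)))"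
      unfolding sum.shift_bounds_cl_Suc_ivl by (simp add: Suc)
    also have "\<dots> = (\<Sum>i=0..m. (1 - q ^ Suc i) * (val {#Suc i#} * val {#Suc (m - i)#}))"
      using Suc by (intro sum.cong) (simp_all add: less)
    also have "\<dots> = of_nat n * val {#Suc n#}"
      using power_sum_rec[of m] by (simp only: Suc atMost_atLeast0)
    finally show ?thesis
      using Suc by (simp del: of_nat_Suc)
  qed
qed

definition normalizer :: "nat list \<Rightarrow> ratfun" where
  "normalizer la = (1 - q) ^ (sum_list la - length la) *
     (q ^ nstat la / (fact (sum_list la - 1) * of_nat (mult_fact la)))"

text \<open>The function \<open>J\<close> as an element of \<open>\<rat>(q)\<close>, which does not presuppose that it is a polynomial.\<close>

definition Jr :: "nat list \<Rightarrow> ratfun" where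
  "Jr la = val (mset la) / normalizer la"

lemma normalizer_nonzero: "normalizer la \<noteq> 0"
  by (simp add: normalizer_def mult_fact_eq mset_mult_fact_pos[THEN less_imp_neq, symmetric])

lemma val_eq_Jr: "val (mset la) = normalizer la * Jr la"
  by (simp add: Jr_def normalizer_nonzero)

lemma normalizer_single: "normalizer [Suc n] = (1 - q) ^ n / fact n"
  by (simp add: normalizer_def nstat_def mult_fact_def)

lemma Jr_1: "Jr [Suc 0] = 1"
  by (simp add: Jr_def normalizer_single val_1)

text \<open>Divide \<open>power_sum_rec\<close> by (1 - q)^(n+1) / n!. The factor 1 - q^(i+1) = (1 -
  q)(1 + q + ... + q^i) supplies the missing power of 1 - q, and the factorials combine to a
  binomial coefficient. Every coefficient is an integer polynomial, whence
  \<open>Jr_single_int\<close>.\<close>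

lemma Jr_single_rec:
  "Jr [Suc (Suc n)] = (\<Sum>i\<le>n. of_nat (n choose i) * (\<Sum>j\<le>i. q ^ j) * Jr [Suc i] * Jr [Suc (n - i)])"
proof -
  have v: "val {#Suc m#} = (1 - q) ^ m / fact m * Jr [Suc m]" for m
    using val_eq_Jr[of "[Suc m]"] by (simp add: normalizer_single)
  have "(1 - q) ^ Suc n / fact n * Jr [Suc (Suc n)] = of_nat (Suc n) * val {#Suc (Suc n)#}"
    by (simp add: v[of "Suc n"] del: of_nat_Suc power_Suc)
  also have "\<dots> = (\<Sum>i\<le>n. (1 - q ^ Suc i) * (val {#Suc i#} * val {#Suc (n - i)#}))"
    by (rule power_sum_rec)
  also have "\<dots> = (\<Sum>i\<le>n. (1 - q) ^ Suc n / fact n *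
      (of_nat (n choose i) * (\<Sum>j\<le>i. q ^ j) * Jr [Suc i] * Jr [Suc (n - i)]))"
  proof (rule sum.cong[OF refl])
    fix i assume i: "i \<in> {..n}"
    have a: "1 - q ^ Suc i = (1 - q) * (\<Sum>j\<le>i. q ^ j)"
      by (simp only: one_diff_power_eq lessThan_Suc_atMost)
    have b: "(1 - q) ^ Suc n = (1 - q) * (1 - q) ^ i * (1 - q) ^ (n - i)"
      using i by (simp flip: power_add mult.assoc)
    have c: "of_nat (n choose i) = (fact n / (fact i * fact (n - i)) :: ratfun)"
      using i by (intro binomial_fact) simp
    show "(1 - q ^ Suc i) * (val {#Suc i#} * val {#Suc (n - i)#}) = (1 - q) ^ Suc n / fact n *
      (of_nat (n choose i) * (\<Sum>j\<le>i. q ^ j) * Jr [Suc i] * Jr [Suc (n - i)])"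
      unfolding a b c v by simp
  qed
  finally have "(1 - q) ^ Suc n / fact n * Jr [Suc (Suc n)] = (1 - q) ^ Suc n / fact n *
      (\<Sum>i\<le>n. of_nat (n choose i) * (\<Sum>j\<le>i. q ^ j) * Jr [Suc i] * Jr [Suc (n - i)])"
    by (simp only: sum_distrib_left)
  moreover have "(1 - q) ^ Suc n / fact n \<noteq> 0"
    by simp
  ultimately show ?thesis
    by (simp only: mult_cancel_left simp_thms)
qed

lemma Jr_single_int: "Jr [Suc n] \<in> int_polys"
proof (induction n rule: less_induct)
  case (less n)
  show ?case
  proof (cases n)
    case (Suc m)
    then show ?thesis
      unfolding Suc Jr_single_rec
      by (intro int_polys_sum int_polys_mult int_polys_of_nat int_polys_power int_polys_q less) (simp_all add: Suc)
  qed (simp add: Jr_1 int_polys_1)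
qed

text \<open>\<open>val_eq_length_sum\<close> rewritten in terms of J. In each summand the powers of
  1 - q with exponents l(\<lambda>) and |\<lambda>| - l(\<lambda>) combine to (1 - q)^(n-1), which
  cancels; the factor n - 1 is (n-1)! / (n-2)!.\<close>

lemma Jr_rhs_single:
  assumes "n \<ge> 2"
  shows "Jr [n] = rhs_single Jr n"
proof -
  obtain m where n: "n = Suc (Suc m)"
    using assms by (metis One_nat_def Suc_1 Suc_le_D Suc_le_mono)
  let ?L = "{la. is_partition la \<and> sum_list la = Suc m}"
  have "Jr [n] = length_sum (Suc m) / ((1 - q) ^ Suc m / fact (Suc m))"
    by (simp add: Jr_def n normalizer_single val_eq_length_sum del: power_Suc fact_Suc)
  also have "length_sum (Suc m) = (\<Sum>la\<in>?L. (1 - q) ^ length la * val (mset la))"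
    unfolding length_sum_def
    by (subst sum.reindex_bij_betw[OF bij_betw_partitions, symmetric]) simp
  also have "\<dots> = (\<Sum>la\<in>?L. (1 - q) ^ Suc m / fact m * (Jr la / of_nat (mult_fact la) * q ^ nstat la))"
  proof (rule sum.cong[OF refl])
    fix la assume la: "la \<in> ?L"
    then have "length la \<le> Suc m"
      using size_le_sum_mset[of "mset la"] by (simp add: is_partition_def sum_mset_sum_list)
    then have "(1 - q) ^ Suc m = (1 - q) ^ length la * (1 - q) ^ (Suc m - length la)"
      by (simp flip: power_add)
    then show "(1 - q) ^ length la * val (mset la)
        = (1 - q) ^ Suc m / fact m * (Jr la / of_nat (mult_fact la) * q ^ nstat la)"
      using la by (simp add: val_eq_Jr normalizer_def)
  qed
  also have "\<dots> = (1 - q) ^ Suc m / fact m * (\<Sum>la\<in>?L. Jr la / of_nat (mult_fact la) * q ^ nstat la)"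
    by (simp only: sum_distrib_left)
  also have "\<dots> / ((1 - q) ^ Suc m / fact (Suc m)) = rhs_single Jr n"
    by (simp add: rhs_single_def n del: of_nat_Suc)
  finally show ?thesis .
qed

end

section \<open>The splitting recurrence\<close>

lemma nstat_append: "nstat (xs @ [x]) = nstat xs + length xs * x"
  by (simp add: nstat_def nth_append)

lemma nstat_update:
  assumes "k < length xs"
  shows "nstat (xs[k := xs ! k + l]) = nstat xs + k * l"
proof -
  have "nstat (xs[k := xs ! k + l]) = (\<Sum>i<length xs. i * xs ! i + (if i = k then k * l else 0))"
    unfolding nstat_def by (intro sum.cong) (auto simp: nth_list_update algebra_simps)
  then show ?thesis
    using assms by (simp add: sum.distrib nstat_def)
qed

lemma is_partition_butlast: "is_partition la \<Longrightarrow> is_partition (butlast la)"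
  by (auto simp: is_partition_def butlast_conv_take sorted_wrt_take dest: in_set_takeD)

lemma last_partition_pos: "is_partition la \<Longrightarrow> la \<noteq> [] \<Longrightarrow> last la > 0"
  using last_in_set[of la] by (metis gr0I is_partition_def)

lemma mset_merge_part:
  assumes "i \<in> {1..length la - 1}"
  shows "mset (merge_part la i)
    = add_mset (butlast la ! (i - 1) + last la) (mset (butlast la) - {#butlast la ! (i - 1)#})"
proof -
  have "la ! (i - 1) = butlast la ! (i - 1)"
    using assms by (intro nth_butlast[symmetric]) auto
  moreover have "i - 1 < length (butlast la)"
    using assms by auto
  ultimately show ?thesis
    by (simp add: merge_part_def merged_def mset_update)
qed

lemma length_merge_part: "length (merge_part la i) = length la - 1"
  by (simp add: merge_part_def merged_def)

lemma sum_list_merge_part: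
  assumes "i \<in> {1..length la - 1}"
  shows "sum_list (merge_part la i) = sum_list la"
proof -
  have "sum_list (merge_part la i) = sum_mset (mset (merge_part la i))"
    by (rule sum_mset_sum_list[symmetric])
  also have "\<dots> = sum_mset (mset (butlast la)) + last la"
  proof -
    have "butlast la ! (i - 1) \<in># mset (butlast la)"
      using assms by auto
    then obtain C where "mset (butlast la) = add_mset (butlast la ! (i - 1)) C"
      by (blast dest: multi_member_split)
    then show ?thesis
      by (simp add: mset_merge_part[OF assms])
  qed
  also have "\<dots> = sum_list (butlast la @ [last la])"
    by (simp add: sum_mset_sum_list)
  also have "\<dots> = sum_list la"
    using assms by (subst append_butlast_last_id) auto
  finally show ?thesis .
qed

lemma is_partition_merge_part:
  assumes "is_partition la" "i \<in> {1..length la - 1}"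
  shows "is_partition (merge_part la i)"
proof -
  have "sorted_wrt (\<ge>) (merge_part la i)"
    by (simp add: merge_part_def sorted_wrt_rev)
  moreover have "0 \<notin> set (merge_part la i)"
  proof
    assume "0 \<in> set (merge_part la i)"
    then have "0 \<in># mset (merge_part la i)"
      by simp
    then have "last la = 0 \<or> 0 \<in> set (butlast la)"
      unfolding mset_merge_part[OF assms(2)] by (auto dest: in_diffD)
    moreover have "la \<noteq> []"
      using assms(2) by auto
    ultimately show False
      using assms last_partition_pos[of la] is_partition_butlast[of la] by (auto simp: is_partition_def)
  qed
  ultimately show ?thesis
    by (simp add: is_partition_def)
qed

lemma length_le_sum_list: "is_partition la \<Longrightarrow> length la \<le> sum_list la"
  using size_le_sum_mset[of "mset la"] by (simp add: is_partition_def sum_mset_sum_list)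

section \<open>Integral Laurent polynomials in q and a criterion for integer polynomials\<close>

definition laurent :: "ratfun set" where
  "laurent = {x. \<exists>K. q ^ K * x \<in> int_polys}"

lemma laurentI: "x \<in> int_polys \<Longrightarrow> x \<in> laurent"
  unfolding laurent_def by (auto intro!: exI[of _ 0])

lemma laurent_add:
  assumes "x \<in> laurent" "y \<in> laurent" shows "x + y \<in> laurent"
proof -
  obtain K L where KL: "q ^ K * x \<in> int_polys" "q ^ L * y \<in> int_polys"
    using assms by (auto simp: laurent_def)
  have "q ^ L * (q ^ K * x) + q ^ K * (q ^ L * y) \<in> int_polys"
    by (intro int_polys_add int_polys_mult[OF int_polys_power[OF int_polys_q]] KL)
  moreover have "q ^ L * (q ^ K * x) + q ^ K * (q ^ L * y) = q ^ (K + L) * (x + y)"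
    by (simp add: power_add algebra_simps)
  ultimately show ?thesis
    unfolding laurent_def by auto
qed

lemma laurent_mult:
  assumes "x \<in> laurent" "y \<in> laurent" shows "x * y \<in> laurent"
proof -
  obtain K L where "q ^ K * x \<in> int_polys" "q ^ L * y \<in> int_polys"
    using assms by (auto simp: laurent_def)
  then have "(q ^ K * x) * (q ^ L * y) \<in> int_polys"
    by (rule int_polys_mult)
  moreover have "(q ^ K * x) * (q ^ L * y) = q ^ (K + L) * (x * y)"
    by (simp add: power_add)
  ultimately show ?thesis
    unfolding laurent_def by auto
qed

lemma laurent_sum: "(\<And>i. i \<in> I \<Longrightarrow> f i \<in> laurent) \<Longrightarrow> sum f I \<in> laurent"
  by (induction I rule: infinite_finite_induct) (auto intro: laurent_add laurentI int_polys_0)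

lemma laurent_powi: "q powi k \<in> laurent"
proof (cases "k \<ge> 0")
  case True
  then show ?thesis
    by (auto simp: power_int_def intro!: laurentI int_polys_power int_polys_q)
next
  case False
  then have "q ^ nat (- k) * q powi k = 1"
    by (simp add: power_int_def field_simps)
  then show ?thesis
    unfolding laurent_def using int_polys_1 by (metis mem_Collect_eq)
qed

text \<open>Modulo x^K the element 1 - x is invertible, with inverse 1 + x + ... + x^(K-1), so its
  powers can be cancelled one at a time.\<close>

lemma power_dvd_cancel_one_minus:
  fixes x a :: "'a::comm_ring_1"
  assumes "x ^ K dvd (1 - x) ^ M * a"
  shows "x ^ K dvd a"
  using assms
proof (induction M)
  case (Suc M)
  let ?b = "(1 - x) ^ M * a"
  have "?b = x ^ K * ?b + (\<Sum>i<K. x ^ i) * ((1 - x) ^ Suc M * a)"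
  proof -
    have "(\<Sum>i<K. x ^ i) * ((1 - x) ^ Suc M * a) = ((1 - x) * (\<Sum>i<K. x ^ i)) * ?b"
      by (simp add: mult_ac)
    also have "\<dots> = (1 - x ^ K) * ?b"
      by (simp only: one_diff_power_eq)
    finally show ?thesis
      by (simp only:) (simp add: left_diff_distrib)
  qed
  then have "x ^ K dvd ?b"
    using Suc.prems by (metis dvd_add dvd_mult dvd_triv_left)
  then show ?case
    by (rule Suc.IH)
qed simp

text \<open>Write x = A / q^K with A an integer polynomial. The second hypothesis says that X^K
  divides (1 - X)^M A over the rationals, so X^K divides A. The quotient is A with its coefficients
  shifted by K, which keeps them integers.\<close>

lemma laurent_rational_poly:
  assumes "x \<in> laurent" "(1 - q) ^ M * x \<in> range to_fract"
  shows "x \<in> int_polys"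
proof -
  let ?X = "[:0, 1:] :: rat poly"
  obtain K A where A: "q ^ K * x = of_int_poly_q A"
    using assms(1) by (auto simp: laurent_def int_polys_def)
  obtain B where B: "(1 - q) ^ M * x = to_fract B"
    using assms(2) by blast
  let ?A = "map_poly rat_of_int A"
  have pow: "to_fract (p ^ n) = to_fract p ^ n" for p :: "rat poly" and n
    by (induction n) simp_all
  have "to_fract (?X ^ K * B) = q ^ K * ((1 - q) ^ M * x)"
    by (simp add: pow flip: B q_def)
  also have "\<dots> = (1 - q) ^ M * of_int_poly_q A"
    by (simp flip: A)
  also have "\<dots> = to_fract ((1 - ?X) ^ M * ?A)"
    by (simp add: of_int_poly_q_def pow q_def)
  finally have "?X ^ K * B = (1 - ?X) ^ M * ?A"
    by (simp only: to_fract_eq_iff)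
  then have "?X ^ K dvd (1 - ?X) ^ M * ?A"
    by (metis dvd_triv_left)
  then have "?X ^ K dvd ?A"
    by (rule power_dvd_cancel_one_minus)
  then have "monom 1 K dvd ?A"
    by (simp add: monom_altdef)
  then have "coeff ?A i = 0" if "i < K" for i
    using that by (auto simp: coeff_monom_mult elim!: dvdE)
  then have "coeff A i = 0" if "i < K" for i
    using that by (simp add: coeff_map_poly)
  then have "A = monom 1 K * poly_shift K A"
    by (auto simp: poly_eq_iff coeff_monom_mult coeff_poly_shift)
  also have "monom 1 K = ([:0, 1:] :: int poly) ^ K"
    by (simp add: monom_altdef)
  finally have "of_int_poly_q A = of_int_poly_q ([:0, 1:] ^ K) * of_int_poly_q (poly_shift K A)"
    by (metis of_int_poly_q_simps(5))
  moreover have "of_int_poly_q ([:0, 1:] ^ K) = q ^ K"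
    by (induction K) (simp_all add: of_int_poly_q_X del: mult_pCons_left)
  ultimately have "q ^ K * x = q ^ K * of_int_poly_q (poly_shift K A)"
    by (simp add: A)
  then show ?thesis
    by (simp add: int_polys_def)
qed

context specialization
begin

text \<open>This is \<open>one_part_product_aug\<close> with l the last part and \<mu> the partition
  without it, solved for the term of \<lambda>. It remains to compare the normalizing factors of the
  partitions involved.\<close>

lemma Jr_rhs_split:
  assumes la: "is_partition la" and len: "length la \<ge> 2"
  shows "Jr la = rhs_split Jr la"
proof -
  define \<mu> l r N where "\<mu> = butlast la" and "l = last la" and "r = length la" and "N = sum_list la"
  note defs = \<mu>_def l_def r_def N_def
  let ?mp = "merge_part la"
  \<comment> \<open>The factor between m(\<lambda>)! m_\<lambda> and J_\<lambda>, in which the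
    multiplicity factorials have cancelled.\<close>
  define W where "W xs = of_nat (mult_fact xs) * normalizer xs" for xs
  have W: "W xs = (1 - q) ^ (sum_list xs - length xs) * q ^ nstat xs / fact (sum_list xs - 1)" for xs
    using mset_mult_fact_pos[of "mset xs"] by (simp add: W_def normalizer_def mult_fact_eq)
  have aug: "aug (mset xs) = W xs * Jr xs" for xs
    by (simp add: aug_def val_eq_Jr W_def mult_fact_eq)
  have "la \<noteq> []"
    using len by auto
  then have la_eq: "la = \<mu> @ [l]"
    by (simp add: defs)
  have l: "l > 0" and \<mu>: "is_partition \<mu>" "0 \<notin># mset \<mu>"
    using la \<open>la \<noteq> []\<close> last_partition_pos[of la] is_partition_butlast[of la] by (auto simp: defs is_partition_def)
  have r: "length \<mu> = r - 1" "r \<ge> 2"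
    using len by (simp_all add: defs)
  have N: "N = sum_list \<mu> + l" "r - 1 \<le> sum_list \<mu>"
    using length_le_sum_list[OF \<mu>(1)] r by (auto simp: N_def la_eq)
  have nla: "nstat la = nstat \<mu> + (r - 1) * l"
    by (simp add: la_eq nstat_append r)
  \<comment> \<open>The powers of 1 - q agree on both sides. The factorials give (N-1)! / ((l-1)!
    (N-l-1)!) = (N-1) binom(N-2, l-1), and removing the last part lowers n(\<lambda>) by (r-1)
    l.\<close>
  have W_ratio: "W [l] * W \<mu> = W la * (of_nat ((N - 1) * ((N - 2) choose (l - 1))) * q powi (- (int (r - 1) * int l)))"
  proof -
    have f: "fact (N - 1) = (of_nat (N - 1) * fact (N - 2) :: ratfun)"
    proof -
      obtain k where "N = Suc (Suc k)"
        using N r l by (intro that[of "N - 2"]) simp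
      then show ?thesis
        by simp
    qed
    have c: "of_nat ((N - 2) choose (l - 1)) = (fact (N - 2) / (fact (l - 1) * fact (sum_list \<mu> - 1)) :: ratfun)"
      using N r l by (subst binomial_fact) auto
    have p: "(1 - q) ^ (N - r) = (1 - q) ^ (l - 1) * (1 - q) ^ (sum_list \<mu> - (r - 1))"
    proof -
      have "N - r = (l - 1) + (sum_list \<mu> - (r - 1))"
        using N r l by simp
      then show ?thesis
        by (simp only: power_add)
    qed
    have w: "q ^ nstat la * q powi (- (int (r - 1) * int l)) = q ^ nstat \<mu>"
    proof -
      have "q powi (- (int (r - 1) * int l)) = inverse (q ^ ((r - 1) * l))"
        by (simp only: power_int_minus power_int_of_nat flip: of_nat_mult)
      then show ?thesis
        by (simp add: nla power_add)
    qed
    have "of_nat ((N - 1) * ((N - 2) choose (l - 1))) / fact (N - 1)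
        = (1 / (fact (l - 1) * fact (sum_list \<mu> - 1)) :: ratfun)"
    proof -
      have "N - 1 \<noteq> 0"
        using N r l by simp
      then have "of_nat (N - 1) \<noteq> (0 :: ratfun)"
        by (simp only: of_nat_eq_0_iff not_False_eq_True)
      then show ?thesis
        unfolding of_nat_mult c f by (simp del: of_nat_diff)
    qed
    moreover have "W la * (of_nat ((N - 1) * ((N - 2) choose (l - 1))) * q powi (- (int (r - 1) * int l)))
        = (1 - q) ^ (N - r) * (q ^ nstat la * q powi (- (int (r - 1) * int l)))
          * (of_nat ((N - 1) * ((N - 2) choose (l - 1))) / fact (N - 1))"
      by (simp add: W flip: N_def r_def)
    ultimately show ?thesis
      unfolding w p by (simp add: W nstat_def r)
  qed
  \<comment> \<open>Merging keeps the size and loses one part, hence the factor 1 - q, which becomes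
    q - 1 on the other side of the equation. Before sorting, the merged list has
    \<open>nstat\<close> equal to n(\<mu>) + (i-1) l, so the two powers of q telescope to exponent
    \<open>nstat (merge_part la i) - nstat la\<close>.\<close>
  have W_merge: "W (?mp i) = W la * ((1 - q) * (q powi (int l * (int i - int r))
      * q powi (int (nstat (?mp i)) - int (nstat (merged la i)))))"
    if i: "i \<in> {1..r - 1}" for i
  proof -
    have "la ! (i - 1) = \<mu> ! (i - 1)"
      unfolding \<mu>_def using i r by (intro nth_butlast[symmetric]) (auto simp: \<mu>_def)
    then have "merged la i = \<mu>[i - 1 := \<mu> ! (i - 1) + l]"
      by (simp add: merged_def \<mu>_def l_def)
    moreover have "i - 1 < length \<mu>"
      using i r by auto
    ultimately have nm: "nstat (merged la i) = nstat \<mu> + (i - 1) * l"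
      by (simp add: nstat_update)
    have "int l * (int i - int r) + (int (nstat (?mp i)) - int (nstat (merged la i))) = int (nstat (?mp i)) - int (nstat la)"
    proof -
      have "int (i - 1) = int i - 1" "int (r - 1) = int r - 1"
        using i r by auto
      then show ?thesis
        by (simp only: nm nla of_nat_add of_nat_mult) (simp add: algebra_simps)
    qed
    then have "q powi (int l * (int i - int r)) * q powi (int (nstat (?mp i)) - int (nstat (merged la i)))
        = q powi (int (nstat (?mp i)) - int (nstat la))"
      using power_int_add[of q] q_nonzero by metis
    also have "\<dots> = q ^ nstat (?mp i) / q ^ nstat la"
      by (simp add: power_int_diff)
    finally have "q powi (int l * (int i - int r)) * q powi (int (nstat (?mp i)) - int (nstat (merged la i)))
        = q ^ nstat (?mp i) / q ^ nstat la" .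
    moreover have "W (?mp i) = (1 - q) ^ Suc (N - r) * q ^ nstat (?mp i) / fact (N - 1)"
    proof -
      have "N - (r - 1) = Suc (N - r)"
        using N l r by simp
      then show ?thesis
        using i by (simp add: W sum_list_merge_part length_merge_part defs)
    qed
    moreover have "W la = (1 - q) ^ (N - r) * q ^ nstat la / fact (N - 1)"
      by (simp add: W defs)
    ultimately show ?thesis
      by simp
  qed
  have "W la * (of_nat ((N - 1) * ((N - 2) choose (l - 1))) * q powi (- (int (r - 1) * int l)) * Jr [l] * Jr \<mu>)
      = (W [l] * W \<mu>) * Jr [l] * Jr \<mu>"
    unfolding W_ratio by (simp only: mult.assoc)
  also have "\<dots> = W [l] * Jr [l] * aug (mset \<mu>)"
    by (simp only: aug mult_ac)
  also have "W [l] * Jr [l] = val {#l#}"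
    using aug[of "[l]"] by (simp add: aug_def mset_mult_fact_def)
  also have "val {#l#} * aug (mset \<mu>) = aug (mset la) + (\<Sum>c\<in>#mset \<mu>. aug (add_mset (c + l) (mset \<mu> - {#c#})))"
    using one_part_product_aug[OF l \<mu>(2)] by (simp add: la_eq)
  also have "(\<Sum>c\<in>#mset \<mu>. aug (add_mset (c + l) (mset \<mu> - {#c#})))
      = (\<Sum>i<r - 1. aug (add_mset (\<mu> ! i + l) (mset \<mu> - {#\<mu> ! i#})))"
    by (simp add: r sum_mset_sum_list sum_list_sum_nth atLeast0LessThan flip: mset_map)
  also have "\<dots> = (\<Sum>i=1..r - 1. aug (mset (?mp i)))"
  proof (rule sum.reindex_bij_witness[where i = "\<lambda>i. i - 1" and j = Suc])
    fix i assume "i \<in> {..<r - 1}"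
    then show "aug (mset (?mp (Suc i))) = aug (add_mset (\<mu> ! i + l) (mset \<mu> - {#\<mu> ! i#}))"
      by (simp add: mset_merge_part defs)
  qed auto
  also have "\<dots> = (\<Sum>i=1..r - 1. W la * ((1 - q) * (q powi (int l * (int i - int r))
      * q powi (int (nstat (?mp i)) - int (nstat (merged la i))))) * Jr (?mp i))"
    by (intro sum.cong) (simp_all only: aug W_merge)
  also have "\<dots> = W la * ((1 - q) * (\<Sum>i=1..r - 1. q powi (int l * (int i - int r))
      * q powi (int (nstat (?mp i)) - int (nstat (merged la i))) * Jr (?mp i)))"
    by (simp only: sum_distrib_left mult.assoc)
  finally have "W la * Jr la = W la * rhs_split Jr la"
    unfolding aug rhs_split_def Let_def \<mu>_def[symmetric] l_def[symmetric] r_def[symmetric] N_def[symmetric]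
    by (simp add: algebra_simps)
  moreover have "W la \<noteq> 0"
    using mset_mult_fact_pos[of "mset la"] by (simp add: W_def normalizer_nonzero mult_fact_eq)
  ultimately show ?thesis
    by simp
qed

text \<open>Every partition on the right-hand side of the splitting equation has fewer parts, and
  partitions with one part are covered by \<open>Jr_single_int\<close>.\<close>

lemma Jr_laurent:
  assumes "is_partition la" "la \<noteq> []"
  shows "Jr la \<in> laurent"
  using assms
proof (induction "length la" arbitrary: la rule: less_induct)
  case less
  have single: "Jr [n] \<in> laurent" if "n > 0" for n
    using that Jr_single_int[of "n - 1"] by (simp add: laurentI)
  show ?case
  proof (cases "length la \<ge> 2")
    case False
    then obtain n where "la = [n]"
      using less.prems(2) by (cases la) (auto simp: Suc_le_eq)
    then show ?thesis
      using less.prems single by (auto simp: is_partition_def)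
  next
    case True
    have "Jr (butlast la) \<in> laurent"
    proof (rule less.hyps)
      show "butlast la \<noteq> []"
        using True by (cases la) auto
    qed (use less.prems True in \<open>auto intro: is_partition_butlast\<close>)
    moreover have "Jr (merge_part la i) \<in> laurent" if "i \<in> {1..length la - 1}" for i
    proof (rule less.hyps)
      show "length (merge_part la i) < length la" "merge_part la i \<noteq> []"
        using True length_merge_part[of la i] by auto
    qed (use less.prems that in \<open>auto intro: is_partition_merge_part\<close>)
    moreover have "Jr [last la] \<in> laurent"
      using last_partition_pos less.prems by (intro single) auto
    moreover have "of_nat n \<in> laurent" "q - 1 \<in> laurent" for n
      by (intro laurentI int_polys_of_nat int_polys_diff int_polys_q int_polys_1)+
    ultimately show ?thesis
      unfolding Jr_rhs_split[OF less.prems(1) True] rhs_split_def Let_def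
      by (intro laurent_add laurent_mult laurent_sum laurent_powi) (auto simp del: of_nat_mult)
  qed
qed

end

section \<open>Divisibility by powers of q\<close>

text \<open>For a partition this is \<open>2 n(\<lambda>) + |\<lambda>|\<close>; in this form it extends to all multisets and is
  superadditive under addition of exponent vectors, because \<open>min\<close> is.\<close>

definition min_sum :: "nat multiset \<Rightarrow> nat" where
  "min_sum A = (\<Sum>a\<in>#A. \<Sum>b\<in>#A. min a b)"

lemma min_sum_add:
  "min_sum (add_mset x A) = min_sum A + x + 2 * (\<Sum>a\<in>#A. min a x)"
proof -
  have "(\<Sum>a\<in>#A. min x a) = (\<Sum>a\<in>#A. min a x)"
    by (simp add: min.commute)
  then show ?thesis
    by (simp add: min_sum_def sum_mset.distrib)
qed

text \<open>The last part x is the smallest, so it contributes x once with itself and twice with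
  each earlier part, matching the increase of 2 n(\<lambda>) + |\<lambda>|.\<close>

lemma min_sum_partition:
  "sorted_wrt (\<ge>) la \<Longrightarrow> min_sum (mset la) = 2 * nstat la + sum_list la"
proof (induction la rule: rev_induct)
  case (snoc x xs)
  have "(\<Sum>a\<in>#mset xs. min a x) = (\<Sum>a\<in>#mset xs. x)"
    using snoc.prems by (intro arg_cong[of _ _ sum_mset] image_mset_cong) (auto simp: sorted_wrt_append)
  then show ?case
    using snoc by (simp add: min_sum_add nstat_append sorted_wrt_append)
qed (simp add: min_sum_def nstat_def)

lemma min_sum_exponents:
  assumes "finite K" "Poly_Mapping.keys \<alpha> \<subseteq> K"
  shows "min_sum (exponents \<alpha>)
    = (\<Sum>i\<in>K. \<Sum>j\<in>K. min (Poly_Mapping.lookup \<alpha> i) (Poly_Mapping.lookup \<alpha> j))"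
proof -
  let ?k = "Poly_Mapping.keys \<alpha>"
  have "min_sum (exponents \<alpha>) = (\<Sum>i\<in>?k. \<Sum>j\<in>?k. min (Poly_Mapping.lookup \<alpha> i) (Poly_Mapping.lookup \<alpha> j))"
    by (simp add: min_sum_def exponents_def sum_unfold_sum_mset multiset.map_comp comp_def)
  also have "\<dots> = (\<Sum>i\<in>?k. \<Sum>j\<in>K. min (Poly_Mapping.lookup \<alpha> i) (Poly_Mapping.lookup \<alpha> j))"
    using assms by (intro sum.cong refl sum.mono_neutral_left) (auto simp: in_keys_iff)
  also have "\<dots> = (\<Sum>i\<in>K. \<Sum>j\<in>K. min (Poly_Mapping.lookup \<alpha> i) (Poly_Mapping.lookup \<alpha> j))"
    using assms by (intro sum.mono_neutral_left) (auto simp: in_keys_iff)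
  finally show ?thesis .
qed

lemma min_sum_superadditive:
  "min_sum (exponents \<beta>) + min_sum (exponents \<gamma>) \<le> min_sum (exponents (\<beta> + \<gamma>))"
proof -
  let ?K = "Poly_Mapping.keys \<beta> \<union> Poly_Mapping.keys \<gamma>"
  have "Poly_Mapping.keys (\<beta> + \<gamma>) \<subseteq> ?K"
    by (rule Poly_Mapping.keys_add)
  then show ?thesis
    by (simp add: min_sum_exponents[of ?K] lookup_add flip: sum.distrib) (intro sum_mono, auto simp: min_def)
qed

lemma min_sum_replicate_1: "min_sum (replicate_mset n 1) = n * n"
  by (simp add: min_sum_def)

section \<open>Removing the first column of a partition\<close>

definition remove_column :: "nat multiset \<Rightarrow> nat multiset" where
  "remove_column A = filter_mset (\<lambda>b. b \<noteq> 0) (image_mset (\<lambda>a. a - 1) A)"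

lemma sum_remove_column: "0 \<notin># A \<Longrightarrow> sum_mset A = size A + sum_mset (remove_column A)"
  by (induction A) (auto simp: remove_column_def)

lemma zero_notin_remove_column: "0 \<notin># remove_column A"
  by (simp add: remove_column_def)

text \<open>For positive a and b, min a b = 1 + min (a-1) (b-1); zero parts add nothing to
  \<open>min_sum\<close>. Together with \<open>min_sum_replicate_1\<close> this is the case of
  equality in \<open>min_sum_superadditive\<close>.\<close>

lemma min_sum_remove_column:
  assumes "0 \<notin># A"
  shows "min_sum A = size A * size A + min_sum (remove_column A)"
proof -
  have zero: "min_sum (filter_mset (\<lambda>b. b \<noteq> 0) B) = min_sum B" for B :: "nat multiset"
    by (induction B) (auto simp: min_sum_add sum_mset_filter intro!: arg_cong[of _ _ sum_mset] image_mset_cong)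
  have "min_sum A = (\<Sum>a\<in>#A. \<Sum>b\<in>#A. 1 + min (a - 1) (b - 1))"
  proof -
    have "min a b = 1 + min (a - 1) (b - 1)" if "a \<in># A" "b \<in># A" for a b
      using that assms by (metis One_nat_def Suc_pred min_Suc_Suc not_gr_zero plus_1_eq_Suc)
    then show ?thesis
      unfolding min_sum_def by (intro arg_cong[of _ _ sum_mset] image_mset_cong) blast
  qed
  also have "\<dots> = size A * size A + min_sum (image_mset (\<lambda>a. a - 1) A)"
    by (simp only: sum_mset.distrib) (simp add: min_sum_def multiset.map_comp comp_def)
  finally show ?thesis
    by (simp only: remove_column_def zero)
qed

lemma filter_nonzero_replicate:
  "M = filter_mset (\<lambda>b. b \<noteq> 0) M + replicate_mset (size M - size (filter_mset (\<lambda>b. b \<noteq> 0) M)) (0::nat)"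
proof (induction M)
  case (add a M)
  then show ?case
    by (cases "a = 0") (auto simp: Suc_diff_le size_filter_mset_lesseq)
qed simp

text \<open>The support of \<beta> already has as many elements as A has parts, so under the size
  bound it is the whole support of \<beta> + \<gamma>. Every exponent of \<gamma> there, zeros
  included, is raised by 1, which undoes the removal of the column.\<close>

lemma add_column_exponents:
  assumes \<beta>: "exponents \<beta> = replicate_mset (size A) 1" and \<gamma>: "exponents \<gamma> = remove_column A"
    and A: "0 \<notin># A" and size: "size (exponents (\<beta> + \<gamma>)) \<le> size A"
  shows "exponents (\<beta> + \<gamma>) = A"
proof -
  let ?K = "Poly_Mapping.keys (\<beta> + \<gamma>)"
  have \<beta>': "card (Poly_Mapping.keys \<beta>) = size A" "\<And>i. Poly_Mapping.lookup \<beta> i \<le> 1"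
    using \<beta> unfolding exponents_eq_replicate_1 by auto
  have sub: "Poly_Mapping.keys \<beta> \<subseteq> ?K" "Poly_Mapping.keys \<gamma> \<subseteq> ?K"
    by (auto simp: in_keys_iff lookup_add)
  then have K: "Poly_Mapping.keys \<beta> = ?K"
    using size \<beta>'(1) by (intro card_seteq) (simp_all add: size_exponents)
  then have cardK: "card ?K = size A"
    using \<beta>'(1) by simp
  have "exponents (\<beta> + \<gamma>) = image_mset (\<lambda>i. Suc (Poly_Mapping.lookup \<gamma> i)) (mset_set ?K)"
    unfolding exponents_def
  proof (rule image_mset_cong)
    fix i assume "i \<in># mset_set ?K"
    then have "i \<in> Poly_Mapping.keys \<beta>"
      by (simp add: K)
    then have "Poly_Mapping.lookup \<beta> i = 1"
      using \<beta>'(2)[of i] by (simp add: in_keys_iff)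
    then show "Poly_Mapping.lookup (\<beta> + \<gamma>) i = Suc (Poly_Mapping.lookup \<gamma> i)"
      by (simp add: lookup_add)
  qed
  also have "\<dots> = image_mset Suc (image_mset (Poly_Mapping.lookup \<gamma>) (mset_set ?K))"
    by (simp add: multiset.map_comp comp_def)
  also have "image_mset (Poly_Mapping.lookup \<gamma>) (mset_set ?K)
      = remove_column A + replicate_mset (size A - size (remove_column A)) 0"
    using sub by (simp add: image_lookup_superset \<gamma> cardK)
  also have "\<dots> = image_mset (\<lambda>a. a - 1) A"
    using filter_nonzero_replicate[of "image_mset (\<lambda>a. a - 1) A"] by (simp add: remove_column_def)
  also have "image_mset Suc \<dots> = A"
  proof -
    have "image_mset (\<lambda>a. Suc (a - 1)) A = image_mset (\<lambda>a. a) A"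
      using A by (intro image_mset_cong) (metis One_nat_def Suc_pred not_gr_zero)
    then show ?thesis
      by (simp add: multiset.map_comp comp_def)
  qed
  finally show ?thesis .
qed

text \<open>The squarefree factor \<beta> has as many variables as \<alpha>, so it must be the
  product of all variables of \<alpha>, and \<gamma> is then determined. Hence m_A has coefficient 1
  in the product of e_r, for r parts, with the monomial function of
  \<open>remove_column A\<close>.\<close>

lemma column_factorization:
  assumes "0 \<notin># A" "exponents \<alpha> = A"
  shows "\<exists>\<beta>0 \<gamma>0. {(\<beta>, \<gamma>). \<beta> + \<gamma> = \<alpha> \<and> exponents \<beta> = replicate_mset (size A) 1 \<and> exponents \<gamma> = remove_column A}
    = {(\<beta>0, \<gamma>0)}"
proof -
  define \<beta>0 :: monomial where "\<beta>0 = Poly_Mapping.map (\<lambda>_. 1) \<alpha>"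
  have l0: "Poly_Mapping.lookup \<beta>0 i = (if i \<in> Poly_Mapping.keys \<alpha> then 1 else 0)" for i
    by (auto simp: \<beta>0_def map.rep_eq when_def in_keys_iff)
  have k0: "Poly_Mapping.keys \<beta>0 = Poly_Mapping.keys \<alpha>"
    by (auto simp: in_keys_iff l0 split: if_splits)
  have card: "card (Poly_Mapping.keys \<alpha>) = size A"
    using assms(2) by (auto simp: size_exponents)
  have e0: "exponents \<beta>0 = replicate_mset (size A) 1"
    unfolding exponents_eq_replicate_1 by (simp add: k0 card l0)
  have s0: "\<beta>0 + (\<alpha> - \<beta>0) = \<alpha>"
    by (intro poly_mapping_eqI) (auto simp: lookup_add lookup_minus l0 in_keys_iff)
  have "exponents (\<alpha> - \<beta>0) = filter_mset (\<lambda>b. b \<noteq> 0) (image_mset (Poly_Mapping.lookup (\<alpha> - \<beta>0)) (mset_set (Poly_Mapping.keys \<alpha>)))"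
    by (rule exponents_superset) (auto simp: in_keys_iff lookup_minus)
  also have "image_mset (Poly_Mapping.lookup (\<alpha> - \<beta>0)) (mset_set (Poly_Mapping.keys \<alpha>))
      = image_mset (\<lambda>i. Poly_Mapping.lookup \<alpha> i - 1) (mset_set (Poly_Mapping.keys \<alpha>))"
    by (intro image_mset_cong) (simp add: lookup_minus l0)
  also have "\<dots> = image_mset (\<lambda>a. a - 1) A"
    using assms(2) by (auto simp: exponents_def multiset.map_comp comp_def)
  finally have r0: "exponents (\<alpha> - \<beta>0) = remove_column A"
    by (simp add: remove_column_def)
  have uniq: "\<beta> = \<beta>0" if "\<beta> + \<gamma> = \<alpha>" "exponents \<beta> = replicate_mset (size A) 1" for \<beta> \<gamma>
  proof -
    have b: "card (Poly_Mapping.keys \<beta>) = size A" "\<And>i. Poly_Mapping.lookup \<beta> i \<le> 1"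
      using that(2) unfolding exponents_eq_replicate_1 by auto
    have "Poly_Mapping.keys \<beta> = Poly_Mapping.keys \<alpha>"
      using b(1) card that(1) by (intro card_seteq) (auto simp: in_keys_iff lookup_add)
    then show ?thesis
      using b(2) by (intro poly_mapping_eqI)
        (metis One_nat_def in_keys_iff l0 le_Suc_eq le_zero_eq)
  qed
  have "{(\<beta>, \<gamma>). \<beta> + \<gamma> = \<alpha> \<and> exponents \<beta> = replicate_mset (size A) 1 \<and> exponents \<gamma> = remove_column A}
    = {(\<beta>0, \<alpha> - \<beta>0)}"
  proof (intro equalityI subsetI)
    fix p assume p: "p \<in> {(\<beta>, \<gamma>). \<beta> + \<gamma> = \<alpha> \<and> exponents \<beta> = replicate_mset (size A) 1 \<and> exponents \<gamma> = remove_column A}"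
    then have "fst p = \<beta>0"
      by (intro uniq[of _ "snd p"]) auto
    moreover have "snd p = \<alpha> - fst p"
      using p by auto
    ultimately show "p \<in> {(\<beta>0, \<alpha> - \<beta>0)}"
      by (simp add: prod_eq_iff)
  qed (simp only: singleton_iff mem_Collect_eq case_prod_conv e0 s0 r0 simp_thms)
  then show ?thesis
    by blast
qed

section \<open>Rational polynomials divisible by a power of q\<close>

lemma of_nat_to_fract: "of_nat n = to_fract (of_nat n)"
  by (induction n) simp_all

definition q_multiples :: "nat \<Rightarrow> ratfun set" where
  "q_multiples n = {q ^ n * to_fract b |b. True}"

lemma q_multiples_add: "x \<in> q_multiples n \<Longrightarrow> y \<in> q_multiples n \<Longrightarrow> x + y \<in> q_multiples n"
  unfolding q_multiples_def by (smt (verit) distrib_left mem_Collect_eq to_fract_add)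

lemma q_multiples_diff: "x \<in> q_multiples n \<Longrightarrow> y \<in> q_multiples n \<Longrightarrow> x - y \<in> q_multiples n"
  unfolding q_multiples_def by (smt (verit) right_diff_distrib mem_Collect_eq to_fract_diff)

lemma q_multiples_mult: "x \<in> q_multiples m \<Longrightarrow> y \<in> q_multiples n \<Longrightarrow> x * y \<in> q_multiples (m + n)"
proof -
  assume "x \<in> q_multiples m" "y \<in> q_multiples n"
  then obtain a b where "x = q ^ m * to_fract a" "y = q ^ n * to_fract b"
    by (auto simp: q_multiples_def)
  then have "x * y = q ^ (m + n) * to_fract (a * b)"
    by (simp add: power_add)
  then show ?thesis
    unfolding q_multiples_def by blast
qed

lemma to_fract_in_q_multiples: "to_fract b \<in> q_multiples 0"
  by (auto simp: q_multiples_def)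

lemma q_power_in_q_multiples: "q ^ n \<in> q_multiples n"
  unfolding q_multiples_def by (auto intro!: exI[of _ 1])

lemma q_multiples_mono:
  assumes "x \<in> q_multiples n" "m \<le> n"
  shows "x \<in> q_multiples m"
proof -
  obtain b where "x = q ^ n * to_fract b"
    using assms by (auto simp: q_multiples_def)
  moreover have "q ^ n = q ^ m * to_fract ([:0, 1:] ^ (n - m))"
  proof -
    have "to_fract ([:0, 1:] ^ k) = q ^ k" for k
      by (induction k) (simp_all add: q_def del: mult_pCons_left)
    then show ?thesis
      using assms(2) by (simp flip: power_add)
  qed
  ultimately have "x = q ^ m * to_fract ([:0, 1:] ^ (n - m) * b)"
    by simp
  then show ?thesis
    unfolding q_multiples_def by blast
qed

lemma q_multiples_sum: "(\<And>i. i \<in> I \<Longrightarrow> f i \<in> q_multiples n) \<Longrightarrow> sum f I \<in> q_multiples n"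
proof (induction I rule: infinite_finite_induct)
  case empty
  have "0 = q ^ n * to_fract 0"
    by simp
  then show ?case
    by (auto simp: q_multiples_def)
next
  case (infinite I)
  have "0 = q ^ n * to_fract 0"
    by simp
  then show ?case
    using infinite by (auto simp: q_multiples_def)
qed (simp add: q_multiples_add)

definition mset_nstat :: "nat multiset \<Rightarrow> nat" where
  "mset_nstat A = nstat (rev (sorted_list_of_multiset A))"

text \<open>Among multisets of equal sum, comparing n is therefore the same as comparing
  \<open>min_sum\<close>, to which superadditivity applies.\<close>

lemma mset_nstat: "min_sum A = 2 * mset_nstat A + sum_mset A"
proof -
  let ?l = "rev (sorted_list_of_multiset A)"
  have "min_sum (mset ?l) = 2 * nstat ?l + sum_list ?l"
    by (rule min_sum_partition) (simp add: sorted_wrt_rev)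
  then show ?thesis
    by (simp add: mset_nstat_def flip: sum_mset_sum_list)
qed

lemma mset_nstat_partition: "is_partition la \<Longrightarrow> mset_nstat (mset la) = nstat la"
  by (simp add: mset_nstat_def rev_sort_partition)

context specialization
begin

text \<open>Expand e_r m_\<mu>, where A has r parts and \<mu> is \<open>remove_column A\<close>. The
  coefficients count factorizations, and the one at A is 1 by \<open>column_factorization\<close>.
  Any other B that occurs has more than r parts by \<open>add_column_exponents\<close>, and n(B)
  \<ge> n(A) because \<open>min_sum\<close> is superadditive with equality at A.\<close>

lemma val_column_expansion:
  assumes A: "0 \<notin># A"
  shows "\<exists>c. val A = val (replicate_mset (size A) 1) * val (remove_column A)
      - (\<Sum>B\<in>{B\<in>mset_partitions (sum_mset A). size A < size B \<and> mset_nstat A \<le> mset_nstat B}. to_fract (c B) * val B)"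
proof -
  let ?e = "mset_series (replicate_mset (size A) 1)" and ?m = "mset_series (remove_column A)"
  let ?N = "sum_mset A"
  let ?Q = "\<lambda>\<alpha>. {(\<beta>, \<gamma>). \<beta> + \<gamma> = \<alpha> \<and> exponents \<beta> = replicate_mset (size A) 1 \<and> exponents \<gamma> = remove_column A}"
  have "series_mult ?e ?m \<in> Sym"
    by (intro series_mult_Sym) simp_all
  then obtain F where F: "series_mult ?e ?m = class_series F" "\<And>\<alpha>. F (exponents \<alpha>) = series_mult ?e ?m \<alpha>"
    using Sym_eq_class_series by blast
  have coeff: "series_mult ?e ?m \<alpha> = of_nat (card (?Q \<alpha>))" for \<alpha>
  proof -
    have "series_mult ?e ?m \<alpha> = (\<Sum>p\<in>{(\<beta>, \<gamma>). \<beta> + \<gamma> = \<alpha>}. if p \<in> ?Q \<alpha> then 1 else 0)"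
      unfolding series_mult_def by (intro sum.cong) (auto simp: mset_series_def class_series_def split: if_splits)
    also have "\<dots> = (\<Sum>p\<in>?Q \<alpha>. 1)"
      by (intro sum.mono_neutral_cong_right) (auto simp: finite_decompositions split: if_splits)
    finally show ?thesis
      by simp
  qed
  have "F A = 1"
  proof -
    obtain \<alpha> where \<alpha>: "exponents \<alpha> = A"
      using A by (rule ex_exponents)
    then have "card (?Q \<alpha>) = 1"
      using column_factorization[OF A \<alpha>] by (metis is_singletonI' is_singleton_altdef is_singleton_def)
    then show ?thesis
      using F(2)[of \<alpha>] coeff[of \<alpha>] by (simp only: \<alpha> of_nat_1)
  qed
  have supp: "sum_mset B = ?N \<and> (B = A \<or> size A < size B \<and> mset_nstat A \<le> mset_nstat B)"
    if B: "0 \<notin># B" "F B \<noteq> 0" for B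
  proof -
    obtain \<alpha> where \<alpha>: "exponents \<alpha> = B"
      using B(1) by (rule ex_exponents)
    then have "?Q \<alpha> \<noteq> {}"
      using B(2) F(2)[of \<alpha>] coeff[of \<alpha>] by (metis card.empty of_nat_0)
    then obtain \<beta> \<gamma> where \<beta>\<gamma>: "\<alpha> = \<beta> + \<gamma>" "exponents \<beta> = replicate_mset (size A) 1" "exponents \<gamma> = remove_column A"
      by auto
    have "sum_mset B = sum_mset (exponents \<beta>) + sum_mset (exponents \<gamma>)"
      by (simp add: sum_mset_exponents mon_degree_add \<beta>\<gamma>(1) flip: \<alpha>)
    then have sum: "sum_mset B = ?N"
      by (simp add: \<beta>\<gamma> sum_remove_column[OF A])
    moreover have "min_sum A \<le> min_sum B"
      using min_sum_superadditive[of \<beta> \<gamma>] \<alpha>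
      by (simp only: \<beta>\<gamma> min_sum_replicate_1 min_sum_remove_column[OF A])
    then have "mset_nstat A \<le> mset_nstat B"
      by (simp add: mset_nstat sum)
    moreover have "B = A" if "size B \<le> size A"
      using add_column_exponents[OF \<beta>\<gamma>(2,3) A] that \<alpha> by (simp add: \<beta>\<gamma>(1))
    ultimately show ?thesis
      by fastforce
  qed
  let ?R = "{B\<in>mset_partitions ?N. size A < size B \<and> mset_nstat A \<le> mset_nstat B}"
  have "val (replicate_mset (size A) 1) * val (remove_column A) = \<phi> (class_series F)"
    by (simp add: val_def \<phi>_mult flip: F(1))
  also have "\<dots> = (\<Sum>B\<in>mset_partitions ?N. F B * val B)"
    using supp by (intro \<phi>_class_series) blast
  also have "\<dots> = (\<Sum>B\<in>insert A ?R. F B * val B)"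
    using supp A finite_mset_partitions by (intro sum.mono_neutral_right) (auto simp: mset_partitions_def)
  also have "\<dots> = val A + (\<Sum>B\<in>?R. F B * val B)"
    using finite_mset_partitions \<open>F A = 1\<close> by (subst sum.insert) auto
  also have "(\<Sum>B\<in>?R. F B * val B)
      = (\<Sum>B\<in>?R. to_fract (of_nat (card (?Q (SOME \<alpha>. exponents \<alpha> = B)))) * val B)"
  proof (rule sum.cong[OF refl])
    fix B assume "B \<in> ?R"
    then have "exponents (SOME \<alpha>. exponents \<alpha> = B) = B"
      by (intro someI_ex[of "\<lambda>\<alpha>. exponents \<alpha> = B"]) (auto simp: mset_partitions_def elim: ex_exponents)
    then have "F B = of_nat (card (?Q (SOME \<alpha>. exponents \<alpha> = B)))"
      using F(2) coeff by metis
    then show "F B * val B = to_fract (of_nat (card (?Q (SOME \<alpha>. exponents \<alpha> = B)))) * val B"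
      by (simp only: of_nat_to_fract)
  qed
  finally show ?thesis
    by (intro exI[of _ "\<lambda>B. of_nat (card (?Q (SOME \<alpha>. exponents \<alpha> = B)))"]) simp
qed

text \<open>In the column expansion the product has smaller-degree factor
  \<open>remove_column A\<close>, while the other terms have the same degree but more parts; hence
  the lexicographic measure. The product has the right power of q because e_r contributes q^binom(r,
  2) and n(A) = binom(r, 2) + n(\<open>remove_column A\<close>).\<close>

lemma val_q_multiple:
  assumes "0 \<notin># A"
  shows "val A \<in> q_multiples (mset_nstat A)"
  using assms
proof (induction A rule: wf_induct[OF wf_measures[of "[sum_mset, \<lambda>A. sum_mset A - size A]"]])
  case (1 A)
  show ?case
  proof (cases "A = {#}")
    case True
    then show ?thesis
      using q_power_in_q_multiples[of 0] by (simp add: val_empty mset_nstat_def nstat_def)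
  next
    case False
    let ?r = "size A"
    have IH: "val B \<in> q_multiples (mset_nstat B)"
      if "0 \<notin># B" "sum_mset B < sum_mset A \<or> sum_mset B = sum_mset A \<and> sum_mset B - size B < sum_mset A - size A" for B
      using 1 that by auto
    obtain c where c: "val A = val (replicate_mset ?r 1) * val (remove_column A)
      - (\<Sum>B\<in>{B\<in>mset_partitions (sum_mset A). ?r < size B \<and> mset_nstat A \<le> mset_nstat B}. to_fract (c B) * val B)"
      using val_column_expansion[OF "1.prems"] by blast
    have "val (remove_column A) \<in> q_multiples (mset_nstat (remove_column A))"
      using sum_remove_column[OF "1.prems"] False by (intro IH) (simp_all add: zero_notin_remove_column nonempty_has_size)
    moreover have "val (replicate_mset ?r 1) \<in> q_multiples (?r choose 2)"
    proof -
      have "fact n * to_fract [:1 / fact n:] = (1 :: ratfun)" for n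
      proof -
        have "fact n = (to_fract [:fact n:] :: ratfun)"
          using of_nat_to_fract[where ?'a = "rat poly" and n = "fact n"] unfolding of_nat_poly unfolding of_nat_fact .
        then show ?thesis
          by (simp flip: to_fract_mult one_pCons)
      qed
      then have "to_fract [:1 / fact ?r:] = (1 / fact ?r :: ratfun)"
        by (simp add: field_simps)
      then have "val (replicate_mset ?r 1) = q ^ (?r choose 2) * to_fract [:1 / fact ?r:]"
        using val_esym[of ?r] by simp
      then show ?thesis
        by (auto simp: q_multiples_def)
    qed
    moreover have "mset_nstat A = (?r choose 2) + mset_nstat (remove_column A)"
    proof -
      have "?r * ?r = ?r + 2 * (?r choose 2)"
        by (cases ?r) (simp_all add: choose_two)
      then show ?thesis
        using min_sum_remove_column[OF "1.prems"] sum_remove_column[OF "1.prems"] by (simp add: mset_nstat)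
    qed
    ultimately have "val (replicate_mset ?r 1) * val (remove_column A) \<in> q_multiples (mset_nstat A)"
      using q_multiples_mult by metis
    moreover have "to_fract (c B) * val B \<in> q_multiples (mset_nstat A)"
      if "B \<in> {B\<in>mset_partitions (sum_mset A). ?r < size B \<and> mset_nstat A \<le> mset_nstat B}" for B
    proof -
      have "val B \<in> q_multiples (mset_nstat B)"
        using that size_le_sum_mset[of B] by (intro IH) (auto simp: mset_partitions_def)
      then have "to_fract (c B) * val B \<in> q_multiples (0 + mset_nstat B)"
        by (intro q_multiples_mult to_fract_in_q_multiples)
      then show ?thesis
        using that by (auto intro: q_multiples_mono)
    qed
    ultimately show ?thesis
      unfolding c by (intro q_multiples_diff q_multiples_sum)
  qed
qed

end

section \<open>The recursive calculation\<close>

context specialization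
begin

text \<open>Up to a natural number factor, (1 - q)^(|\<lambda>| - l(\<lambda>)) J_\<lambda> is
  m_\<lambda> divided by q^n(\<lambda>), a rational polynomial by \<open>val_q_multiple\<close>.
  With the integral Laurent property from the splitting equation,
  \<open>laurent_rational_poly\<close> applies.\<close>

lemma Jr_int:
  assumes "is_partition la" "la \<noteq> []"
  shows "Jr la \<in> int_polys"
proof (rule laurent_rational_poly)
  show "Jr la \<in> laurent"
    using assms by (rule Jr_laurent)
  have "val (mset la) \<in> q_multiples (nstat la)"
    using val_q_multiple[of "mset la"] assms
    by (simp add: mset_nstat_partition) (simp add: is_partition_def)
  then obtain b where b: "val (mset la) = q ^ nstat la * to_fract b"
    by (auto simp: q_multiples_def)
  let ?c = "fact (sum_list la - 1) * mult_fact la"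
  have nz: "(1 - q) ^ (sum_list la - length la) \<noteq> 0" "q ^ nstat la \<noteq> 0" "of_nat (mult_fact la) \<noteq> (0 :: ratfun)"
    "fact (sum_list la - 1) \<noteq> (0 :: ratfun)"
    using mset_mult_fact_pos[of "mset la"] by (simp_all add: mult_fact_eq)
  have "(1 - q) ^ (sum_list la - length la) * Jr la = of_nat ?c * to_fract b"
    using nz by (simp add: Jr_def b normalizer_def)
  also have "of_nat ?c = (to_fract (of_nat ?c) :: ratfun)"
    by (rule of_nat_to_fract)
  finally show "(1 - q) ^ (sum_list la - length la) * Jr la \<in> range to_fract"
    by (metis rangeI to_fract_mult)
qed

text \<open>The definite description in \<open>J\<close> is justified here: existence is
  \<open>Jr_int\<close>, uniqueness holds because the normalizing factor is nonzero and integer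
  polynomials embed into Q(q).\<close>

lemma Jq_eq_Jr:
  assumes "is_partition la" "la \<noteq> []"
  shows "Jq \<phi> la = Jr la"
proof -
  obtain p where p: "Jr la = of_int_poly_q p"
    using Jr_int[OF assms] by (auto simp: int_polys_def)
  have iff: "\<phi> (msym la) = normalizer la * of_int_poly_q p' \<longleftrightarrow> p' = p" for p'
    using val_eq_Jr[of la] p normalizer_nonzero[of la]
    by (auto simp: val_def msym_eq_mset_series)
  have "J \<phi> la = p"
    unfolding J_def normalizer_def[symmetric] iff by (rule the_equality) simp_all
  then show ?thesis
    by (simp add: p)
qed

text \<open>Only the values of \<open>K\<close> that occur on the right-hand side matter. This is
  needed because \<open>Jr\<close> and \<open>Jq \<phi>\<close> are known to agree only on nonempty
  partitions, and the \<open>K\<close> in \<open>calculated\<close> is known only where values have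
  been obtained.\<close>

lemma rhs_split_cong:
  assumes "K [last la] = K' [last la]" "K (butlast la) = K' (butlast la)"
    and "\<And>i. i \<in> {1..length la - 1} \<Longrightarrow> K (merge_part la i) = K' (merge_part la i)"
  shows "rhs_split K la = rhs_split K' la"
  unfolding rhs_split_def Let_def assms(1,2)
  by (intro arg_cong2[of _ _ _ _ "(+)"] arg_cong2[of _ _ _ _ "(*)"] refl sum.cong assms(3))

lemma rhs_single_cong:
  assumes "\<And>la. is_partition la \<Longrightarrow> sum_list la = n - 1 \<Longrightarrow> K la = K' la"
  shows "rhs_single K n = rhs_single K' n"
  unfolding rhs_single_def using assms by (intro arg_cong2[of _ _ _ _ "(*)"] refl sum.cong) simp

lemma J_1: "J \<phi> [1] = 1"
proof -
  have "Jq \<phi> [1] = of_int_poly_q 1"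
    using Jq_eq_Jr[of "[1]"] by (simp add: is_partition_def Jr_1)
  then show ?thesis
    by (simp only: of_int_poly_q_inject)
qed

lemma Jq_split:
  assumes "is_partition la" "length la \<ge> 2"
  shows "Jq \<phi> la = rhs_split (Jq \<phi>) la"
proof -
  have la: "la \<noteq> []"
    using assms(2) by auto
  have "Jq \<phi> la = rhs_split Jr la"
    using Jq_eq_Jr[OF assms(1) la] Jr_rhs_split[OF assms] by simp
  also have "\<dots> = rhs_split (Jq \<phi>) la"
  proof (rule rhs_split_cong)
    show "Jr [last la] = Jq \<phi> [last la]"
      using last_partition_pos[OF assms(1) la] by (intro Jq_eq_Jr[symmetric]) (auto simp: is_partition_def)
    show "Jr (butlast la) = Jq \<phi> (butlast la)"
    proof (intro Jq_eq_Jr[symmetric] is_partition_butlast assms(1))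
      have "length (butlast la) \<noteq> 0"
        using assms(2) by simp
      then show "butlast la \<noteq> []"
        by blast
    qed
    fix i assume i: "i \<in> {1..length la - 1}"
    have "length (merge_part la i) \<noteq> 0"
      using assms(2) by (simp add: length_merge_part)
    then show "Jr (merge_part la i) = Jq \<phi> (merge_part la i)"
      using assms(1) i by (intro Jq_eq_Jr[symmetric] is_partition_merge_part) auto
  qed
  finally show ?thesis .
qed

lemma Jq_single:
  assumes "n \<ge> 2"
  shows "Jq \<phi> [n] = rhs_single (Jq \<phi>) n"
proof -
  have "Jq \<phi> [n] = rhs_single Jr n"
    using assms Jq_eq_Jr[of "[n]"] Jr_rhs_single[OF assms] by (simp add: is_partition_def)
  also have "\<dots> = rhs_single (Jq \<phi>) n"
  proof (rule rhs_single_cong)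
    fix la assume "is_partition la" "sum_list la = n - 1"
    then show "Jr la = Jq \<phi> la"
      using assms by (intro Jq_eq_Jr[symmetric]) auto
  qed
  finally show ?thesis .
qed

lemma calculated_imp_eq: "calculated la v \<Longrightarrow> v = Jq \<phi> la"
proof (induction rule: calculated.induct)
  case start
  show ?case
    by (simp add: J_1[simplified])
next
  case (split la K)
  then show ?case
    using rhs_split_cong[of K la "Jq \<phi>"] by (simp add: Jq_split)
next
  case (single n K)
  then show ?case
    using rhs_single_cong[of n K "Jq \<phi>"] by (simp add: Jq_single)
qed

text \<open>The recursion terminates since both equations descend lexicographically in size and then
  length: the one-row equation lowers the size by 1, the split-off part and the remaining partition
  have smaller size, and each merged partition has the same size and one part less.\<close>

lemma calculated_Jq:
  assumes "is_partition la" "la \<noteq> []"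
  shows "calculated la (Jq \<phi> la)"
  using assms
proof (induction la rule: wf_induct[OF wf_measures[of "[sum_list, length]"]])
  case (1 la)
  have IH: "calculated xs (Jq \<phi> xs)"
    if "is_partition xs" "xs \<noteq> []" "sum_list xs < sum_list la \<or> sum_list xs = sum_list la \<and> length xs < length la" for xs
    using 1 that by auto
  consider "length la \<ge> 2" | n where "la = [n]"
    using "1.prems"(2) by (cases la rule: remdups_adj.cases) auto
  then show ?case
  proof cases
    case 1
    have b: "is_partition (butlast la)" "butlast la \<noteq> []"
      using is_partition_butlast[OF \<open>is_partition la\<close>] 1 by (auto simp flip: length_0_conv)
    have l: "last la > 0"
      using last_partition_pos \<open>is_partition la\<close> \<open>la \<noteq> []\<close> by blast
    have sum: "sum_list la = sum_list (butlast la) + last la"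
      using \<open>la \<noteq> []\<close> by (metis append_butlast_last_id sum_list.append sum_list.Cons sum_list.Nil add_0_right)
    have "sum_list (butlast la) > 0"
      using length_le_sum_list[OF b(1)] b(2) by (metis gr0I le_zero_eq length_0_conv)
    then have "calculated la (rhs_split (Jq \<phi>) la)"
      using 1 b l sum \<open>is_partition la\<close>
      by (intro calculated.split IH is_partition_merge_part)
        (auto simp: is_partition_def sum_list_merge_part length_merge_part simp flip: length_0_conv)
    then show ?thesis
      using Jq_split[OF \<open>is_partition la\<close> 1] by simp
  next
    case (2 n)
    show ?thesis
    proof (cases "n \<ge> 2")
      case True
      have "calculated [n] (rhs_single (Jq \<phi>) n)"
        using True 2 by (intro calculated.single IH) auto
      then show ?thesis
        using Jq_single[OF True] 2 by simp
    next
      case False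
      then have "la = [1]"
        using 2 \<open>is_partition la\<close> by (auto simp: is_partition_def)
      then show ?thesis
        using calculated.start by (simp add: J_1[simplified])
    qed
  qed
qed

end

theorem corollary3p7:
  fixes \<phi> :: "series \<Rightarrow> ratfun"
  assumes "is_specialization \<phi>"
  shows "J \<phi> [1] = 1
    \<and> (\<forall>la. is_partition la \<and> length la \<ge> 2 \<longrightarrow> Jq \<phi> la = rhs_split (Jq \<phi>) la)
    \<and> (\<forall>n\<ge>2. Jq \<phi> [n] = rhs_single (Jq \<phi>) n)
    \<and> (\<forall>la. is_partition la \<and> la \<noteq> [] \<longrightarrow> (\<forall>v. calculated la v \<longleftrightarrow> v = Jq \<phi> la))"
proof -
  interpret specialization \<phi>
    using assms by unfold_locales
  show ?thesis
    using J_1 Jq_split Jq_single calculated_imp_eq calculated_Jq by blast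
qed

end
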